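(* Fix $N_2\in\mathbb{N}$ and $\eta\in(0,1)$. The first-order condition numbers $\mathcal{K}_y(n)$ and $\mathcal{K}_\lambda(n)$ satisfy the following. Regime 1 ($\Delta>0$ fixed): there exist $\gamma_y(\eta,\Delta),\gamma_\lambda(\eta,\Delta),\Gamma(\eta)>0$ such that, for all sufficiently large $N_1$, $$\max_{1\le n\le\lfloor\eta N_1\rfloor}|\mathcal{K}_y(n)|\le\gamma_y(\eta,\Delta)e^{-\Gamma(\eta)\Delta N_1^3},\qquad \max_{1\le n\le\lfloor\eta N_1\rfloor}|\mathcal{K}_\lambda(n)|\le\gamma_\lambda(\eta,\Delta)e^{-\Gamma(\eta)\Delta N_1^3}.$$ Regime 2 ($N_1$ large and fixed, $\Delta\to\infty$): given any $\vartheta>0$, there exist $N_1(\vartheta)\in\mathbb{N}$ and $\gamma_y(\eta,\vartheta),\gamma_\lambda(\eta,\vartheta)>0$ such that, for all $N_1\ge N_1(\vartheta)$, when $\Delta$ is sufficiently large, $$\max_{1\le n\le\lfloor\eta N_1\rfloor}|\mathcal{K}_y(n)|\le\gamma_y(\eta,\vartheta)e^{-\vartheta\Delta},\qquad \max_{1\le n\le\lfloor\eta N_1\rfloor}|\mathcal{K}_\lambda(n)|\le\frac{\gamma_\lambda(\eta,\vartheta)}{\Delta}e^{-\vartheta\Delta}.$$ Regime 3 ($N_1\Delta=T>0$ with $T$ fixed): there exist $\gamma_y(\eta,T),\gamma_\lambda(\eta,T),\Gamma(\eta,T)>0$ such that, for all sufficiently large $N_1$ (with $\Delta=T/N_1$),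 $$\max_{1\le n\le\lfloor\eta N_1\rfloor}|\mathcal{K}_y(n)|\le\gamma_y(\eta,T)e^{-\Gamma(\eta,T)N_1^2},\qquad \max_{1\le n\le\lfloor\eta N_1\rfloor}|\mathcal{K}_\lambda(n)|\le\gamma_\lambda(\eta,T)e^{-\Gamma(\eta,T)N_1^2}.$$
   Context: Let $\mathcal{A}$ be a fixed Sturm-Liouville operator $[\mathcal{A}h](x)=-(p(x)h'(x))'-q(x)h(x)$, $x\in(0,1)$, with domain $\{h\in \mathrm{H}^2(0,1): h(0)=h(1)=0\}$, where $p,q$ are smooth real functions on $[0,1]$ (restrictions of smooth functions defined on a neighborhood of $[0,1]$) and $\min_{[0,1]}p>0$. Let $\{\lambda_n\}_{n=1}^\infty$ be the monotonically increasing, unbounded real sequence of its simple eigenvalues. For $\Delta>0$ put $\phi_n:=e^{-\lambda_n\Delta}$. The real amplitudes $y_1,\dots,y_{N_1+N_2}$ satisfy, with constants $\ell>1$ and $M_y>0$ that do not depend on $N_1$ or $\Delta$: $\ell^{-1}\le|y_n|\le\ell$ for $1\le n\le N_1$, and $|y_n|/|y_k|\le M_y$ for all $1\le k\le N_1$ and $N_1+1\le n\le N_1+N_2$. For $\hat P=(\{\hat y_n\}_{n=1}^{N_1},\{\hat\lambda_n\}_{n=1}^{N_1})$ let $$\mathcal{F}(\hat P,\varepsilon)=\Big(\sum_{n=1}^{N_1}\hat y_n e^{-\hat\lambda_n k\Delta}-\sum_{n=1}^{N_1}y_n e^{-\lambda_n k\Delta}-\varepsilon\sum_{n=N_1+1}^{N_1+N_2}y_n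 e^{-\lambda_n k\Delta}\Big)_{k=0}^{2N_1-1}.$$ For $|\varepsilon|$ small, $\hat P(\varepsilon)=(\{\hat y_n(\varepsilon)\},\{\hat\lambda_n(\varepsilon)\})$ denotes the continuously differentiable solution branch of $\mathcal{F}(\hat P(\varepsilon),\varepsilon)=0$ with $\hat y_n(0)=y_n$, $\hat\lambda_n(0)=\lambda_n$. The first-order condition numbers are $\mathcal{K}_y(n)=\frac{\mathrm{d}\hat y_n}{\mathrm{d}\varepsilon}(0)$ and $\mathcal{K}_\lambda(n)=\frac{\mathrm{d}\hat\lambda_n}{\mathrm{d}\varepsilon}(0)$, $1\le n\le N_1$. Explicitly, $$\mathcal{K}_y(n)=\sum_{m=N_1+1}^{N_1+N_2}y_m H_n(\phi_m),\qquad \mathcal{K}_\lambda(n)=-\frac{1}{\Delta y_n\phi_n}\sum_{m=N_1+1}^{N_1+N_2}y_m\tilde H_n(\phi_m),$$ where $L_n(z)=\prod_{j\in\{1,\dots,N_1\},\,j\ne n}\frac{z-\phi_j}{\phi_n-\phi_j}$, $H_n(z)=[1-2(z-\phi_n)L_n'(\phi_n)]L_n(z)^2$, $\tilde H_n(z)=(z-\phi_n)L_n(z)^2$. *)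

theory Defs
  imports "HOL-Analysis.Analysis"
begin

definition smooth_on_unit_interval :: "(real \<Rightarrow> real) \<Rightarrow> bool" where
  "smooth_on_unit_interval f \<longleftrightarrow>
     (\<exists>g U. open U \<and> {0..1} \<subseteq> U \<and>
        (\<forall>k. \<forall>x\<in>U. (deriv ^^ k) g field_differentiable at x) \<and>
        (\<forall>x\<in>{0..1}. f x = g x))"

(* f is the absolutely continuous representative of an element of the Sobolev space H^1(0,1)
   and g in L^2(0,1) is its weak derivative; g matters only up to null sets. *)
definition H1_derivative :: "(real \<Rightarrow> real) \<Rightarrow> (real \<Rightarrow> real) \<Rightarrow> bool" where
  "H1_derivative f g \<longleftrightarrow>
     set_borel_measurable lebesgue {0..1} g \<and>
     set_integrable lebesgue {0..1} (\<lambda>x. (g x)\<^sup>2) \<and>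
     (\<forall>x\<in>{0..1}. f x = f 0 + (LINT t:{0..x}|lebesgue. g t))"

definition sobolev_H2 :: "(real \<Rightarrow> real) set" where
  "sobolev_H2 = {h. \<exists>h1 h2. H1_derivative h h1 \<and> H1_derivative h1 h2}"

definition SL_domain :: "(real \<Rightarrow> real) set" where
  "SL_domain = {h \<in> sobolev_H2. h 0 = 0 \<and> h 1 = 0}"

(* The graph of the operator: f = - (p h')' - q h as elements of L^2(0,1). Here h1 = h', in its
   continuous representative, and g = (p h')' as a weak derivative. *)
definition SL_operator ::
    "(real \<Rightarrow> real) \<Rightarrow> (real \<Rightarrow> real) \<Rightarrow> (real \<Rightarrow> real) \<Rightarrow> (real \<Rightarrow> real) \<Rightarrow> bool" where
  "SL_operator p q h f \<longleftrightarrow> h \<in> SL_domain \<and>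
     (\<exists>h1 g. H1_derivative h h1 \<and> H1_derivative (\<lambda>x. p x * h1 x) g \<and>
        (AE x\<in>{0<..<1} in lebesgue. f x = - g x - q x * h x))"

definition SL_eigenfunction ::
    "(real \<Rightarrow> real) \<Rightarrow> (real \<Rightarrow> real) \<Rightarrow> real \<Rightarrow> (real \<Rightarrow> real) \<Rightarrow> bool" where
  "SL_eigenfunction p q \<mu> h \<longleftrightarrow>
     (\<exists>x\<in>{0..1}. h x \<noteq> 0) \<and> SL_operator p q h (\<lambda>x. \<mu> * h x)"

definition SL_eigenvalue :: "(real \<Rightarrow> real) \<Rightarrow> (real \<Rightarrow> real) \<Rightarrow> real \<Rightarrow> bool" where
  "SL_eigenvalue p q \<mu> \<longleftrightarrow> (\<exists>h. SL_eigenfunction p q \<mu> h)"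

definition SL_simple_eigenvalue :: "(real \<Rightarrow> real) \<Rightarrow> (real \<Rightarrow> real) \<Rightarrow> real \<Rightarrow> bool" where
  "SL_simple_eigenvalue p q \<mu> \<longleftrightarrow> SL_eigenvalue p q \<mu> \<and>
     (\<forall>h g. SL_eigenfunction p q \<mu> h \<and> SL_eigenfunction p q \<mu> g \<longrightarrow>
        (\<exists>c. \<forall>x\<in>{0..1}. g x = c * h x))"

(* Sequences are indexed from 1; the value at 0 is irrelevant. *)
definition SL_eigenvalue_sequence ::
    "(real \<Rightarrow> real) \<Rightarrow> (real \<Rightarrow> real) \<Rightarrow> (nat \<Rightarrow> real) \<Rightarrow> bool" where
  "SL_eigenvalue_sequence p q lam \<longleftrightarrow>
     strict_mono_on {1..} lam \<and>
     filterlim lam at_top sequentially \<and>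
     lam ` {1..} = {\<mu>. SL_eigenvalue p q \<mu>} \<and>
     (\<forall>n\<ge>1. SL_simple_eigenvalue p q (lam n))"

definition admissible_amplitudes ::
    "real \<Rightarrow> real \<Rightarrow> nat \<Rightarrow> nat \<Rightarrow> (nat \<Rightarrow> real) \<Rightarrow> bool" where
  "admissible_amplitudes l M N1 N2 y \<longleftrightarrow>
     (\<forall>n\<in>{1..N1}. inverse l \<le> \<bar>y n\<bar> \<and> \<bar>y n\<bar> \<le> l) \<and>
     (\<forall>k\<in>{1..N1}. \<forall>n\<in>{N1+1..N1+N2}. \<bar>y n\<bar> / \<bar>y k\<bar> \<le> M)"

(* Component k of the system, to be considered for k < 2 * N1. *)
definition prony_residual ::
    "nat \<Rightarrow> nat \<Rightarrow> real \<Rightarrow> (nat \<Rightarrow> real) \<Rightarrow> (nat \<Rightarrow> real) \<Rightarrow>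
     (nat \<Rightarrow> real) \<Rightarrow> (nat \<Rightarrow> real) \<Rightarrow> real \<Rightarrow> nat \<Rightarrow> real" where
  "prony_residual N1 N2 \<Delta> lam y yh lamh \<epsilon> k =
     (\<Sum>n=1..N1. yh n * exp (- lamh n * real k * \<Delta>))
     - (\<Sum>n=1..N1. y n * exp (- lam n * real k * \<Delta>))
     - \<epsilon> * (\<Sum>n=N1+1..N1+N2. y n * exp (- lam n * real k * \<Delta>))"

definition solution_branch ::
    "nat \<Rightarrow> nat \<Rightarrow> real \<Rightarrow> (nat \<Rightarrow> real) \<Rightarrow> (nat \<Rightarrow> real) \<Rightarrow>
     (real \<Rightarrow> nat \<Rightarrow> real) \<Rightarrow> (real \<Rightarrow> nat \<Rightarrow> real) \<Rightarrow> bool" where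
  "solution_branch N1 N2 \<Delta> lam y yh lamh \<longleftrightarrow>
     (\<exists>r>0.
        (\<forall>n\<in>{1..N1}. (\<lambda>\<epsilon>. yh \<epsilon> n) C1_differentiable_on {-r<..<r} \<and>
                      (\<lambda>\<epsilon>. lamh \<epsilon> n) C1_differentiable_on {-r<..<r}) \<and>
        (\<forall>\<epsilon>\<in>{-r<..<r}. \<forall>k<2*N1. prony_residual N1 N2 \<Delta> lam y (yh \<epsilon>) (lamh \<epsilon>) \<epsilon> k = 0)) \<and>
     (\<forall>n\<in>{1..N1}. yh 0 n = y n \<and> lamh 0 n = lam n)"

(* Applied to the amplitude component of a branch this is K_y(n), to the exponent component
   K_lambda(n). *)
definition condition_number :: "(real \<Rightarrow> nat \<Rightarrow> real) \<Rightarrow> nat \<Rightarrow> real" where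
  "condition_number X n = deriv (\<lambda>\<epsilon>. X \<epsilon> n) 0"

definition max_condition :: "real \<Rightarrow> nat \<Rightarrow> (real \<Rightarrow> nat \<Rightarrow> real) \<Rightarrow> real" where
  "max_condition \<eta> N1 X = (MAX n\<in>{1..nat \<lfloor>\<eta> * real N1\<rfloor>}. \<bar>condition_number X n\<bar>)"

end

theory Submission
  imports Defs "HOL-Computational_Algebra.Polynomial" "HOL-Real_Asymp.Real_Asymp"
begin

text \<open>
  Differentiating the Prony system at \<open>\<epsilon> = 0\<close> shows that the condition numbers solve a confluent
  Vandermonde system in the nodes \<open>\<phi> n = exp (- lam n * \<Delta>)\<close>, \<open>n \<le> N1\<close>. Testing it with the
  Hermite basis polynomials expresses them through the values of \<open>(L n)\<^sup>2\<close> at the neglected nodes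
  \<open>\<phi> m\<close>, \<open>m > N1\<close>, where \<open>L n\<close> is the Lagrange basis polynomial
  (\<open>confluent_vandermonde_solution\<close>).

  In the product \<open>L n (\<phi> m)\<close> a factor with \<open>j > n\<close> is of order \<open>\<phi> j / \<phi> n\<close>, since
  \<open>\<phi> m < \<phi> j < \<phi> n\<close>, and a factor with \<open>j < n\<close> is of order one. The product is therefore at
  most \<open>D ^ N1 * exp (- \<Delta> * S)\<close>, where \<open>S\<close> is the sum of \<open>lam j - lam n\<close> over \<open>n < j \<le> N1\<close> and
  \<open>D = 1 / (1 - exp (- \<kappa> * \<Delta>))\<close> for a uniform spectral gap \<open>\<kappa>\<close>
  (\<open>lagrange_poly_truncated_node\<close>). For \<open>n \<le> \<eta> * N1\<close> a quadratic separation of the eigenvalues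
  makes \<open>S\<close> at least a multiple of \<open>N1 ^ 3\<close>, and this beats the factor \<open>D ^ N1\<close> in all three
  regimes: \<open>D\<close> is fixed in the first, tends to one in the second and is of order \<open>N1\<close> in the third.

  The spectrum enters through one fact: two large eigenvalues \<open>\<mu> < \<mu>'\<close> satisfy
  \<open>\<mu>' - \<mu> \<ge> c * sqrt \<mu>\<close> (\<open>SL_eigenvalue_gap\<close>). Then \<open>sqrt (lam n)\<close> grows at least linearly, and
  the gaps \<open>lam (Suc n) - lam n\<close> do so too. The gap estimate is an orthogonality argument. Normalise the two
  eigenfunctions \<open>h\<close>, \<open>k\<close> to the same initial slope. Gronwall estimates for the energy
  \<open>\<mu> * h\<^sup>2 + (p * h')\<^sup>2 / p\<close> show that \<open>h\<close> and \<open>k\<close> are of size \<open>1 / sqrt \<mu>\<close>, that the integral of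
  \<open>h\<^sup>2\<close> is at least of order \<open>1 / \<mu>\<close>, and that \<open>k - h\<close> is at most of order \<open>(\<mu>' - \<mu>) / \<mu>\<close>. If
  \<open>\<mu>' - \<mu>\<close> were much smaller than \<open>sqrt \<mu>\<close>, the integral of \<open>h * k\<close> would be positive, although it
  vanishes.
\<close>

section \<open>Classical regularity of eigenfunctions\<close>

lemma smooth_on_unit_interval_C1:
  assumes "smooth_on_unit_interval f"
  obtains f' where "continuous_on {0..1} f'"
    and "\<And>x. x \<in> {0..1} \<Longrightarrow> (f has_real_derivative f' x) (at x within {0..1})"
proof -
  obtain g U where U: "open U" "{0..1} \<subseteq> U"
    and diff: "\<And>k x. x \<in> U \<Longrightarrow> (deriv ^^ k) g field_differentiable at x"
    and fg: "\<And>x. x \<in> {0..1} \<Longrightarrow> f x = g x"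
    using assms unfolding smooth_on_unit_interval_def by blast
  have cont: "continuous_on {0..1} (deriv g)"
  proof (rule continuous_at_imp_continuous_on, rule ballI)
    fix x :: real assume "x \<in> {0..1}"
    then show "isCont (deriv g) x"
      using diff[of x 1] U by (intro field_differentiable_imp_continuous_at) auto
  qed
  have der: "(f has_real_derivative deriv g x) (at x within {0..1})" if x: "x \<in> {0..1}" for x
  proof -
    have "(g has_real_derivative deriv g x) (at x)"
      using diff[of x 0] x U by (auto simp: DERIV_deriv_iff_field_differentiable)
    then have "(g has_real_derivative deriv g x) (at x within {0..1})"
      by (rule DERIV_subset) simp
    then show ?thesis
      by (rule has_field_derivative_transform_within[where d=1]) (use x fg in auto)
  qed
  show thesis by (rule that[OF cont der])
qed

text \<open>
  A weak derivative is determined up to null sets only. Once it agrees almost everywhere with a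
  continuous function, the fundamental theorem of calculus makes it a classical derivative.
\<close>

lemma H1_derivative_continuous_representative:
  assumes f: "H1_derivative f g"
    and G: "continuous_on {0..1} G"
    and eq: "AE x\<in>{0<..<1} in lebesgue. g x = G x"
    and x: "x \<in> {0..1}"
  shows "(f has_real_derivative G x) (at x within {0..1})"
proof -
  have gm: "set_borel_measurable lebesgue {0..1} g"
    and fint: "\<And>x. x \<in> {0..1} \<Longrightarrow> f x = f 0 + (LINT t:{0..x}|lebesgue. g t)"
    using f unfolding H1_derivative_def by blast+
  have rep: "f t = f 0 + integral {0..t} G" if t: "t \<in> {0..1}" for t
  proof -
    have sub: "{0..t} \<subseteq> {0..1}" using t by auto
    have Gc: "continuous_on {0..t} G" by (rule continuous_on_subset[OF G sub])
    have Gi: "set_integrable lebesgue {0..t} G"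
      using absolutely_integrable_continuous_real[OF Gc] .
    have gm': "set_borel_measurable lebesgue {0..t} g"
      by (rule set_borel_measurable_subset[OF gm _ sub]) simp
    \<comment> \<open>The equation is given on the open interval; the two end points form a null set.\<close>
    have neg: "AE x in lebesgue. x \<notin> {0, 1::real}"
      by (rule AE_not_in) (simp add: null_sets_completionI)
    have "(LINT s:{0..t}|lebesgue. g s) = (LINT s:{0..t}|lebesgue. G s)"
      unfolding set_lebesgue_integral_def
    proof (rule integral_cong_AE)
      show "(\<lambda>x. indicat_real {0..t} x *\<^sub>R g x) \<in> borel_measurable lebesgue"
        using gm' by (simp add: set_borel_measurable_def)
      show "(\<lambda>x. indicat_real {0..t} x *\<^sub>R G x) \<in> borel_measurable lebesgue"
        using Gi by (simp add: set_integrable_def borel_measurable_integrable)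
      show "AE x in lebesgue. indicat_real {0..t} x *\<^sub>R g x = indicat_real {0..t} x *\<^sub>R G x"
        using eq neg
      proof eventually_elim
        case (elim s)
        then show ?case using t by (cases "s \<in> {0..t}") auto
      qed
    qed
    also have "\<dots> = integral {0..t} G"
      by (rule set_lebesgue_integral_eq_integral(2)[OF Gi])
    finally show ?thesis using fint[OF t] by simp
  qed
  have "((\<lambda>t. f 0 + integral {0..t} G) has_real_derivative G x) (at x within {0..1})"
    using integral_has_real_derivative[OF G x] by (auto intro!: derivative_eq_intros)
  then show ?thesis
    by (rule has_field_derivative_transform_within[where d=1]) (use x in \<open>simp_all add: rep[symmetric]\<close>)
qed

text \<open>
  On an interval of finite length, square integrability of the weak derivative gives
  integrability, through \<open>\<bar>g\<bar> \<le> 1 + g\<^sup>2\<close>; hence the primitive is continuous.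
\<close>

lemma H1_derivative_continuous:
  assumes f: "H1_derivative f g"
  shows "continuous_on {0..1} f"
proof -
  have gm: "set_borel_measurable lebesgue {0..1} g"
    and g2: "set_integrable lebesgue {0..1} (\<lambda>x. (g x)\<^sup>2)"
    and fint: "\<And>x. x \<in> {0..1} \<Longrightarrow> f x = f 0 + (LINT t:{0..x}|lebesgue. g t)"
    using f unfolding H1_derivative_def by blast+
  have one: "set_integrable lebesgue {0..1} (\<lambda>x. 1 + (g x)\<^sup>2)"
    by (intro set_integral_add g2) (simp add: absolutely_integrable_continuous_real)
  have gi: "set_integrable lebesgue {0..1} g"
  proof (rule set_integrable_bound[OF one gm])
    have "\<bar>y\<bar> \<le> 1 + y\<^sup>2" for y :: real
      using sum_squares_ge_zero[of "\<bar>y\<bar> - 1" 0] sum_squares_bound[of "\<bar>y\<bar>" 1]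
      by (simp add: power2_eq_square)
    then show "AE x in lebesgue. x \<in> {0..1} \<longrightarrow> norm (g x) \<le> norm (1 + (g x)\<^sup>2)"
      by (auto intro: order_trans[OF _ abs_ge_self])
  qed
  have "continuous_on {0..1} (\<lambda>x. f 0 + integral {0..x} g)"
    by (intro continuous_intros indefinite_integral_continuous_1
        set_lebesgue_integral_eq_integral(1)[OF gi])
  then show ?thesis
  proof (rule continuous_on_eq)
    fix x :: real assume x: "x \<in> {0..1}"
    have "set_integrable lebesgue {0..x} g"
      by (rule set_integrable_subset[OF gi]) (use x in auto)
    from set_lebesgue_integral_eq_integral(2)[OF this] fint[OF x]
    show "f 0 + integral {0..x} g = f x" by simp
  qed
qed

text \<open>
  Elliptic regularity in one dimension. The flux \<open>u = p * h'\<close> is continuous, being in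
  \<open>H\<^sup>1\<close>, so \<open>h' = u / p\<close> is continuous; then the right-hand side of the eigenvalue equation is
  continuous and \<open>u\<close> is continuously differentiable as well.
\<close>

lemma SL_eigenfunction_classical:
  assumes p: "continuous_on {0..1} p" "\<And>x. x \<in> {0..1} \<Longrightarrow> 0 < p x"
    and q: "continuous_on {0..1} q"
    and h: "SL_eigenfunction p q \<mu> h"
  obtains u where
    "\<And>x. x \<in> {0..1} \<Longrightarrow> (h has_real_derivative u x / p x) (at x within {0..1})"
    "\<And>x. x \<in> {0..1} \<Longrightarrow> (u has_real_derivative - (q x + \<mu>) * h x) (at x within {0..1})"
    "h 0 = 0" "h 1 = 0" "\<exists>x\<in>{0..1}. h x \<noteq> 0"
proof -
  obtain h1 g where h1: "H1_derivative h h1" and g: "H1_derivative (\<lambda>x. p x * h1 x) g"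
    and ae: "AE x\<in>{0<..<1} in lebesgue. \<mu> * h x = - g x - q x * h x"
    and dom: "h \<in> SL_domain" and ne: "\<exists>x\<in>{0..1}. h x \<noteq> 0"
    using h by (auto simp: SL_eigenfunction_def SL_operator_def)
  define u where "u x = p x * h1 x" for x
  have hc: "continuous_on {0..1} h" by (rule H1_derivative_continuous[OF h1])
  have uc: "continuous_on {0..1} u"
    unfolding u_def by (rule H1_derivative_continuous[OF g])
  have h1u: "h1 x = u x / p x" if "x \<in> {0..1}" for x
    using p(2)[OF that] by (simp add: u_def)
  have quot: "continuous_on {0..1} (\<lambda>x. u x / p x)"
    using p by (intro continuous_intros uc p(1)) (auto dest: p(2))
  have 1: "(h has_real_derivative u x / p x) (at x within {0..1})" if "x \<in> {0..1}" for x
    by (rule H1_derivative_continuous_representative[OF h1 quot _ that]) (use h1u in auto)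
  have ae': "AE x\<in>{0<..<1} in lebesgue. g x = - (q x + \<mu>) * h x"
    using ae by eventually_elim (auto simp: algebra_simps)
  have 2: "(u has_real_derivative - (q x + \<mu>) * h x) (at x within {0..1})" if "x \<in> {0..1}" for x
    unfolding u_def
    by (rule H1_derivative_continuous_representative[OF g _ ae' that])
      (intro continuous_intros q hc)
  show thesis
    using that[OF 1 2 _ _ ne] dom by (simp add: SL_domain_def)
qed

section \<open>Energy estimates and the spectral gap\<close>

lemma gronwall_upper:
  fixes E E' :: "real \<Rightarrow> real"
  assumes der: "\<And>x. x \<in> {0..1} \<Longrightarrow> (E has_real_derivative E' x) (at x within {0..1})"
    and le: "\<And>x. x \<in> {0..1} \<Longrightarrow> E' x \<le> C * E x + F"
    and "0 \<le> C" "0 \<le> F" "0 \<le> E 0" and x: "x \<in> {0..1}"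
  shows "E x \<le> (E 0 + F) * exp C"
proof -
  define g where "g x = exp (- C * x) * E x - F * x" for x
  have "g x \<le> g 0"
  proof (rule DERIV_nonpos_imp_decreasing_open[of 0 x g])
    show "0 \<le> x" using x by simp
    have "continuous_on {0..1} g"
      unfolding g_def by (intro continuous_intros DERIV_continuous_on[OF der])
    then show "continuous_on {0..x} g"
      by (rule continuous_on_subset) (use x in auto)
    fix t assume "0 < t" "t < x"
    then have t: "0 < t" "t < 1" "t \<in> {0..1}" using x by auto
    have "(E has_real_derivative E' t) (at t)"
      using der[OF t(3)] t(1,2) by (simp add: at_within_Icc_at)
    then have "(g has_real_derivative exp (- C * t) * (E' t - C * E t) - F) (at t)"
      unfolding g_def by (auto intro!: derivative_eq_intros simp: algebra_simps)
    moreover have "exp (- C * t) * (E' t - C * E t) \<le> exp (- C * t) * F"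
      using le[OF t(3)] by (intro mult_left_mono) auto
    moreover have "exp (- C * t) * F \<le> 1 * F"
      using assms t by (intro mult_right_mono) auto
    ultimately show "\<exists>y. DERIV g t :> y \<and> y \<le> 0"
      by (intro exI[of _ "exp (- C * t) * (E' t - C * E t) - F"] conjI) linarith+
  qed
  then have "exp (- C * x) * E x \<le> E 0 + F * x" by (simp add: g_def)
  also have "\<dots> \<le> E 0 + F" using x assms by (simp add: mult_left_le)
  finally have "exp (C * x) * (exp (- C * x) * E x) \<le> exp (C * x) * (E 0 + F)"
    by (intro mult_left_mono) auto
  then have "E x \<le> (E 0 + F) * exp (C * x)"
    by (simp add: mult.assoc[symmetric] exp_add[symmetric] mult.commute[of "E 0"] mult.commute[of "E 0 + F"])
  also have "\<dots> \<le> (E 0 + F) * exp C"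
    using x assms by (intro mult_left_mono) (auto simp: mult_left_le)
  finally show ?thesis .
qed

lemma gronwall_lower:
  fixes E E' :: "real \<Rightarrow> real"
  assumes der: "\<And>x. x \<in> {0..1} \<Longrightarrow> (E has_real_derivative E' x) (at x within {0..1})"
    and ge: "\<And>x. x \<in> {0..1} \<Longrightarrow> - C * E x \<le> E' x"
    and "0 \<le> C" "0 \<le> E 0" and x: "x \<in> {0..1}"
  shows "E 0 * exp (- C) \<le> E x"
proof -
  define g where "g x = exp (C * x) * E x" for x
  have "g 0 \<le> g x"
  proof (rule DERIV_nonneg_imp_increasing_open[of 0 x g])
    show "0 \<le> x" using x by simp
    have "continuous_on {0..1} g"
      unfolding g_def by (intro continuous_intros DERIV_continuous_on[OF der])
    then show "continuous_on {0..x} g"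
      by (rule continuous_on_subset) (use x in auto)
    fix t assume "0 < t" "t < x"
    then have t: "0 < t" "t < 1" "t \<in> {0..1}" using x by auto
    have "(E has_real_derivative E' t) (at t)"
      using der[OF t(3)] t(1,2) by (simp add: at_within_Icc_at)
    then have "(g has_real_derivative exp (C * t) * (E' t + C * E t)) (at t)"
      unfolding g_def by (auto intro!: derivative_eq_intros simp: algebra_simps)
    then show "\<exists>y. DERIV g t :> y \<and> y \<ge> 0"
      using ge[OF t(3)] by (intro exI[of _ "exp (C * t) * (E' t + C * E t)"]) auto
  qed
  then have "exp (- (C * x)) * E 0 \<le> exp (- (C * x)) * (exp (C * x) * E x)"
    by (intro mult_left_mono) (auto simp: g_def)
  then have "E 0 * exp (- (C * x)) \<le> E x"
    by (simp add: mult.assoc[symmetric] exp_add[symmetric] mult.commute[of "E 0"] mult.commute[of "E 0 + F"])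
  moreover have "E 0 * exp (- C) \<le> E 0 * exp (- (C * x))"
    using x assms by (intro mult_left_mono) (auto simp: mult_left_le)
  ultimately show ?thesis by simp
qed

locale SL_coefficients =
  fixes p p' q :: "real \<Rightarrow> real" and m P Q :: real
  assumes p_deriv: "\<And>x. x \<in> {0..1} \<Longrightarrow> (p has_real_derivative p' x) (at x within {0..1})"
    and q_cont: "continuous_on {0..1} q"
    and m_pos: "0 < m"
    and p_ge: "\<And>x. x \<in> {0..1} \<Longrightarrow> m \<le> p x"
    and p'_le: "\<And>x. x \<in> {0..1} \<Longrightarrow> \<bar>p' x\<bar> \<le> P"
    and q_le: "\<And>x. x \<in> {0..1} \<Longrightarrow> \<bar>q x\<bar> \<le> Q"
begin

text \<open>
  The exponential rate at which the energy of a solution can grow or decay. It does not depend on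
  the spectral parameter, and this uniformity is what the whole gap estimate rests on.
\<close>

definition rate :: real where "rate = Q * (1 + 1 / m) + P / m"

text \<open>
  Here \<open>u\<close> stands for the flux \<open>p * h'\<close>, so the second term is \<open>p * h'\<^sup>2\<close>. The weight \<open>\<mu>\<close> is
  chosen such that the terms with \<open>\<mu>\<close> cancel in the derivative of the energy along solutions.
\<close>

definition energy :: "real \<Rightarrow> (real \<Rightarrow> real) \<Rightarrow> (real \<Rightarrow> real) \<Rightarrow> real \<Rightarrow> real" where
  "energy \<mu> h u x = \<mu> * (h x)\<^sup>2 + (u x)\<^sup>2 / p x"

text \<open>
  The equation \<open>- (p h')' - q h = \<mu> h + f\<close> as a first-order system for \<open>h\<close> and its flux \<open>u\<close>.
\<close>

definition solves :: "real \<Rightarrow> (real \<Rightarrow> real) \<Rightarrow> (real \<Rightarrow> real) \<Rightarrow> (real \<Rightarrow> real) \<Rightarrow> bool" where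
  "solves \<mu> f h u \<longleftrightarrow> (\<forall>x\<in>{0..1}.
     (h has_real_derivative u x / p x) (at x within {0..1}) \<and>
     (u has_real_derivative - (q x + \<mu>) * h x - f x) (at x within {0..1}))"

lemma p_pos: "x \<in> {0..1} \<Longrightarrow> 0 < p x"
  using p_ge[of x] m_pos by auto

lemma Q_nonneg: "0 \<le> Q"
  using q_le[of 0] by auto

lemma P_nonneg: "0 \<le> P"
  using p'_le[of 0] by auto

lemma rate_nonneg: "0 \<le> rate"
  using Q_nonneg P_nonneg m_pos by (simp add: rate_def)

lemma p_cont: "continuous_on {0..1} p"
  by (rule DERIV_continuous_on[OF p_deriv])

lemma solves_cont:
  assumes "solves \<mu> f h u"
  shows "continuous_on {0..1} h" "continuous_on {0..1} u"
proof -
  have d: "\<And>x. x \<in> {0..1} \<Longrightarrow> (h has_real_derivative u x / p x) (at x within {0..1})"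
    "\<And>x. x \<in> {0..1} \<Longrightarrow> (u has_real_derivative - (q x + \<mu>) * h x - f x) (at x within {0..1})"
    using assms unfolding solves_def by blast+
  show "continuous_on {0..1} h" by (rule DERIV_continuous_on[OF d(1)])
  show "continuous_on {0..1} u" by (rule DERIV_continuous_on[OF d(2)])
qed

lemma energy_deriv:
  assumes "solves \<mu> f h u" and x: "x \<in> {0..1}"
  shows "(energy \<mu> h u has_real_derivative
     - (2 * q x * h x * u x / p x + (u x)\<^sup>2 * p' x / (p x)\<^sup>2) - 2 * f x * u x / p x)
     (at x within {0..1})"
  unfolding energy_def
  using assms p_deriv[OF x] p_pos[OF x] unfolding solves_def
  by (auto intro!: derivative_eq_intros simp: power2_eq_square) (simp add: field_simps)

text \<open>
  Both terms are quadratic in \<open>(h, u)\<close> with bounded coefficients, and for \<open>\<mu> \<ge> 1\<close> the energy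
  dominates \<open>h\<^sup>2\<close> as well as \<open>u\<^sup>2 / p\<close>.
\<close>

lemma energy_flux_bound:
  assumes x: "x \<in> {0..1}" and \<mu>: "1 \<le> \<mu>"
  shows "\<bar>2 * q x * h x * u x / p x + (u x)\<^sup>2 * p' x / (p x)\<^sup>2\<bar> \<le> rate * energy \<mu> h u x"
proof -
  let ?E = "energy \<mu> h u x"
  have pp: "0 < p x" "m \<le> p x" using p_pos[OF x] p_ge[OF x] by auto
  have h2: "(h x)\<^sup>2 \<le> ?E"
    using \<mu> pp mult_right_mono[of 1 \<mu> "(h x)\<^sup>2"] by (simp add: energy_def add_increasing2)
  have u2: "(u x)\<^sup>2 / p x \<le> ?E"
    using \<mu> by (simp add: energy_def)
  have E0: "0 \<le> ?E" using h2 by (rule order_trans[rotated]) simp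
  have "2 * \<bar>h x\<bar> * \<bar>u x\<bar> \<le> (h x)\<^sup>2 + (u x)\<^sup>2"
    using sum_squares_bound[of "\<bar>h x\<bar>" "\<bar>u x\<bar>"] by simp
  then have "2 * \<bar>h x\<bar> * \<bar>u x\<bar> / p x \<le> (h x)\<^sup>2 / p x + (u x)\<^sup>2 / p x"
    using pp by (simp add: add_divide_distrib[symmetric] divide_right_mono)
  also have "(h x)\<^sup>2 / p x \<le> (h x)\<^sup>2 / m"
    using pp m_pos by (intro divide_left_mono) auto
  also have "(h x)\<^sup>2 / m \<le> ?E / m"
    using h2 m_pos by (intro divide_right_mono) auto
  finally have hu: "2 * \<bar>h x\<bar> * \<bar>u x\<bar> / p x \<le> ?E * (1 + 1 / m)"
    using u2 by (simp add: algebra_simps)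
  have "\<bar>2 * q x * h x * u x / p x\<bar> = \<bar>q x\<bar> * (2 * \<bar>h x\<bar> * \<bar>u x\<bar> / p x)"
    using pp by (simp add: abs_mult)
  also have "\<dots> \<le> Q * (?E * (1 + 1 / m))"
    by (intro mult_mono hu q_le x Q_nonneg) (use pp in auto)
  finally have 1: "\<bar>2 * q x * h x * u x / p x\<bar> \<le> Q * (1 + 1 / m) * ?E"
    by (simp add: mult_ac)
  have "\<bar>(u x)\<^sup>2 * p' x / (p x)\<^sup>2\<bar> = \<bar>p' x\<bar> / p x * ((u x)\<^sup>2 / p x)"
    using pp by (simp add: abs_mult power2_eq_square)
  also have "\<dots> \<le> P / m * ?E"
    by (intro mult_mono u2 frac_le p'_le x pp m_pos P_nonneg)
      (use pp m_pos P_nonneg in auto)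
  finally have 2: "\<bar>(u x)\<^sup>2 * p' x / (p x)\<^sup>2\<bar> \<le> P / m * ?E" .
  show ?thesis
    using 1 2 abs_triangle_ineq[of "2 * q x * h x * u x / p x" "(u x)\<^sup>2 * p' x / (p x)\<^sup>2"]
    by (simp add: rate_def distrib_right)
qed

lemma energy_nonneg: "x \<in> {0..1} \<Longrightarrow> 0 \<le> \<mu> \<Longrightarrow> 0 \<le> energy \<mu> h u x"
  using p_pos[of x] by (simp add: energy_def)

lemma energy_upper:
  assumes s: "solves \<mu> (\<lambda>_. 0) h u" and \<mu>: "1 \<le> \<mu>" and x: "x \<in> {0..1}"
  shows "energy \<mu> h u x \<le> energy \<mu> h u 0 * exp rate"
proof -
  have "energy \<mu> h u x \<le> (energy \<mu> h u 0 + 0) * exp rate"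
  proof (rule gronwall_upper[OF energy_deriv[OF s] _ rate_nonneg _ _ x])
    fix t :: real assume t: "t \<in> {0..1}"
    show "- (2 * q t * h t * u t / p t + (u t)\<^sup>2 * p' t / (p t)\<^sup>2) - 2 * 0 * u t / p t
        \<le> rate * energy \<mu> h u t + 0"
      using energy_flux_bound[OF t \<mu>, of h u] by (simp add: abs_le_iff)
  qed (use energy_nonneg \<mu> in auto)
  then show ?thesis by simp
qed

lemma energy_lower:
  assumes s: "solves \<mu> (\<lambda>_. 0) h u" and \<mu>: "1 \<le> \<mu>" and x: "x \<in> {0..1}"
  shows "energy \<mu> h u 0 * exp (- rate) \<le> energy \<mu> h u x"
proof (rule gronwall_lower[OF energy_deriv[OF s] _ rate_nonneg _ x])
  fix t :: real assume t: "t \<in> {0..1}"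
  show "- rate * energy \<mu> h u t
      \<le> - (2 * q t * h t * u t / p t + (u t)\<^sup>2 * p' t / (p t)\<^sup>2) - 2 * 0 * u t / p t"
    using energy_flux_bound[OF t \<mu>, of h u] by (simp add: abs_le_iff)
qed (use energy_nonneg \<mu> in auto)

text \<open>
  The forcing contributes \<open>- 2 * f * u / p \<le> f\<^sup>2 / p + u\<^sup>2 / p\<close>; the last term is absorbed by the
  energy, which raises the rate by one.
\<close>

lemma energy_forced:
  assumes s: "solves \<mu> f h u" and \<mu>: "1 \<le> \<mu>" and x: "x \<in> {0..1}"
    and f: "\<And>x. x \<in> {0..1} \<Longrightarrow> (f x)\<^sup>2 \<le> F"
    and init: "h 0 = 0" "u 0 = 0"
  shows "energy \<mu> h u x \<le> F / m * exp (rate + 1)"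
proof -
  have F0: "0 \<le> F" using f[of 0] by (auto intro: order_trans[rotated])
  have E0: "energy \<mu> h u 0 = 0" by (simp add: energy_def init)
  have "energy \<mu> h u x \<le> (energy \<mu> h u 0 + F / m) * exp (rate + 1)"
  proof (rule gronwall_upper[OF energy_deriv[OF s] _ _ _ _ x])
    fix t :: real assume t: "t \<in> {0..1}"
    have pp: "0 < p t" "m \<le> p t" using p_pos[OF t] p_ge[OF t] by auto
    have "- 2 * f t * u t \<le> (f t)\<^sup>2 + (u t)\<^sup>2"
      using zero_le_power2[of "f t + u t"] by (simp add: power2_sum)
    from divide_right_mono[OF this, of "p t"] pp
    have "- 2 * f t * u t / p t \<le> (f t)\<^sup>2 / p t + (u t)\<^sup>2 / p t"
      by (simp add: add_divide_distrib)
    also have "(f t)\<^sup>2 / p t \<le> F / m"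
      using pp m_pos f[OF t] F0 by (intro frac_le) auto
    also have "(u t)\<^sup>2 / p t \<le> energy \<mu> h u t" using \<mu> by (simp add: energy_def)
    finally show "- (2 * q t * h t * u t / p t + (u t)\<^sup>2 * p' t / (p t)\<^sup>2) - 2 * f t * u t / p t
        \<le> (rate + 1) * energy \<mu> h u t + F / m"
      using energy_flux_bound[OF t \<mu>, of h u] by (simp add: abs_le_iff distrib_right)
  qed (use rate_nonneg F0 m_pos E0 in auto)
  then show ?thesis using E0 by simp
qed

lemma solves_scale:
  assumes "solves \<mu> (\<lambda>_. 0) h u"
  shows "solves \<mu> (\<lambda>_. 0) (\<lambda>x. c * h x) (\<lambda>x. c * u x)"
  using assms unfolding solves_def
  by (auto intro!: derivative_eq_intros simp: algebra_simps)

text \<open>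
  An eigenfunction with vanishing initial flux would have zero energy throughout, so it can be
  rescaled to have initial flux one. With this normalisation, eigenfunctions for nearby eigenvalues
  are close to each other.
\<close>

lemma normalised_eigenfunction:
  assumes \<mu>: "1 \<le> \<mu>" and "SL_eigenvalue p q \<mu>"
  obtains h u where "solves \<mu> (\<lambda>_. 0) h u" "h 0 = 0" "h 1 = 0" "u 0 = 1"
proof -
  obtain h0 where "SL_eigenfunction p q \<mu> h0"
    using assms by (auto simp: SL_eigenvalue_def)
  from SL_eigenfunction_classical[OF p_cont p_pos q_cont this]
  obtain u0 where der: "\<And>x. x \<in> {0..1} \<Longrightarrow> (h0 has_real_derivative u0 x / p x) (at x within {0..1})"
    "\<And>x. x \<in> {0..1} \<Longrightarrow> (u0 has_real_derivative - (q x + \<mu>) * h0 x) (at x within {0..1})"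
    and bc: "h0 0 = 0" "h0 1 = 0" and ne: "\<exists>x\<in>{0..1}. h0 x \<noteq> 0"
    by metis
  have s: "solves \<mu> (\<lambda>_. 0) h0 u0" unfolding solves_def using der by simp
  have u0: "u0 0 \<noteq> 0"
  proof
    assume "u0 0 = 0"
    then have "energy \<mu> h0 u0 0 = 0" using bc by (simp add: energy_def)
    then have E: "energy \<mu> h0 u0 x \<le> 0" if "x \<in> {0..1}" for x
      using energy_upper[OF s \<mu> that] by simp
    have "h0 x = 0" if x: "x \<in> {0..1}" for x
    proof -
      have "0 \<le> (u0 x)\<^sup>2 / p x" using p_pos[OF x] by simp
      then have "\<mu> * (h0 x)\<^sup>2 \<le> 0" using E[OF x] by (simp add: energy_def)
      then show ?thesis using \<mu> by (simp add: mult_le_0_iff)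
    qed
    then show False using ne by auto
  qed
  show thesis
    by (rule that[OF solves_scale[OF s, of "1 / u0 0"]]) (use bc u0 in auto)
qed

lemma has_integral_FTC:
  assumes "\<And>x. x \<in> {0..1} \<Longrightarrow> (F has_real_derivative f x) (at x within {0..1})"
  shows "(f has_integral F 1 - F 0) {0..1::real}"
  using fundamental_theorem_of_calculus[of 0 1 F f] assms
  by (simp add: has_real_derivative_iff_has_vector_derivative)

text \<open>
  The Wronskian \<open>h * v - k * u\<close> vanishes at both ends, and its derivative is
  \<open>(\<mu> - \<mu>') * h * k\<close>.
\<close>

lemma eigenfunctions_orthogonal:
  assumes h: "solves \<mu> (\<lambda>_. 0) h u" "h 0 = 0" "h 1 = 0"
    and k: "solves \<mu>' (\<lambda>_. 0) k v" "k 0 = 0" "k 1 = 0"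
    and ne: "\<mu> \<noteq> \<mu>'"
  shows "((\<lambda>x. h x * k x) has_integral 0) {0..1}"
proof -
  have "((\<lambda>x. (\<mu> - \<mu>') * (h x * k x)) has_integral (h 1 * v 1 - k 1 * u 1) - (h 0 * v 0 - k 0 * u 0)) {0..1}"
    by (rule has_integral_FTC)
      (use h(1) k(1) in \<open>auto simp: solves_def field_simps intro!: derivative_eq_intros\<close>)
  then have "((\<lambda>x. (\<mu> - \<mu>') * (h x * k x)) has_integral 0) {0..1}"
    using h k by simp
  from has_integral_mult_right[OF this, of "1 / (\<mu> - \<mu>')"] show ?thesis using ne by simp
qed

text \<open>
  Integrating the derivative of \<open>h * u\<close>, which vanishes at both ends, gives the equipartition
  identity: the integrals of \<open>u\<^sup>2 / p\<close> and of \<open>(q + \<mu>) * h\<^sup>2\<close> agree. So the energy, which is bounded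
  below, has the same integral as \<open>(2 * \<mu> + q) * h\<^sup>2\<close>.
\<close>

lemma eigenfunction_mass:
  assumes h: "solves \<mu> (\<lambda>_. 0) h u" "h 0 = 0" "h 1 = 0" "u 0 = 1" and \<mu>: "1 \<le> \<mu>"
  shows "exp (- rate) / p 0 / ((2 + Q) * \<mu>) \<le> integral {0..1} (\<lambda>x. (h x)\<^sup>2)"
proof -
  have hc: "continuous_on {0..1} h" by (rule solves_cont[OF h(1)])
  have "((\<lambda>x. (u x)\<^sup>2 / p x - (q x + \<mu>) * (h x)\<^sup>2) has_integral h 1 * u 1 - h 0 * u 0) {0..1}"
    by (rule has_integral_FTC)
      (use h(1) in \<open>auto simp: solves_def power2_eq_square algebra_simps intro!: derivative_eq_intros\<close>)
  then have equi: "((\<lambda>x. (u x)\<^sup>2 / p x - (q x + \<mu>) * (h x)\<^sup>2) has_integral 0) {0..1}"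
    using h by simp
  have i2: "(\<lambda>x. (h x)\<^sup>2) integrable_on {0..1}"
    by (intro integrable_continuous_real continuous_intros hc)
  then have I: "((\<lambda>x. (2 + Q) * \<mu> * (h x)\<^sup>2) has_integral (2 + Q) * \<mu> * integral {0..1} (\<lambda>x. (h x)\<^sup>2)) {0..1}"
    by (intro has_integral_mult_right integrable_integral)
  have sum: "((\<lambda>x. (2 + Q) * \<mu> * (h x)\<^sup>2 + ((u x)\<^sup>2 / p x - (q x + \<mu>) * (h x)\<^sup>2)) has_integral
      (2 + Q) * \<mu> * integral {0..1} (\<lambda>x. (h x)\<^sup>2)) {0..1}"
    using has_integral_add[OF I equi] by simp
  have const: "((\<lambda>x. exp (- rate) / p 0) has_integral exp (- rate) / p 0) {0..1::real}"
    using has_integral_const_real[of "exp (- rate) / p 0" 0 1] by simp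
  have "exp (- rate) / p 0 \<le> (2 + Q) * \<mu> * integral {0..1} (\<lambda>x. (h x)\<^sup>2)"
  proof (rule has_integral_le[OF const sum])
    fix x :: real assume x: "x \<in> {0..1}"
    have E0: "energy \<mu> h u 0 = 1 / p 0" using h by (simp add: energy_def)
    have "exp (- rate) / p 0 \<le> \<mu> * (h x)\<^sup>2 + (u x)\<^sup>2 / p x"
      using energy_lower[OF h(1) \<mu> x] unfolding E0 by (simp add: energy_def)
    also have "q x \<le> Q * \<mu>"
      using q_le[OF x] \<mu> Q_nonneg mult_left_mono[of 1 \<mu> Q] by (auto simp: abs_le_iff)
    then have "q x * (h x)\<^sup>2 \<le> Q * \<mu> * (h x)\<^sup>2"
      by (intro mult_right_mono) auto
    then have "\<mu> * (h x)\<^sup>2 + (u x)\<^sup>2 / p x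
        \<le> (2 + Q) * \<mu> * (h x)\<^sup>2 + ((u x)\<^sup>2 / p x - (q x + \<mu>) * (h x)\<^sup>2)"
      by (simp add: algebra_simps)
    finally show "exp (- rate) / p 0
        \<le> (2 + Q) * \<mu> * (h x)\<^sup>2 + ((u x)\<^sup>2 / p x - (q x + \<mu>) * (h x)\<^sup>2)" .
  qed
  then show ?thesis
    using \<mu> Q_nonneg by (subst pos_divide_le_eq) (auto simp: mult_ac intro!: mult_pos_pos)
qed

text \<open>
  The difference \<open>w = k - h\<close> of two normalised eigenfunctions has zero initial data and is driven
  by \<open>(\<mu>' - \<mu>) * k\<close>, so it is of order \<open>(\<mu>' - \<mu>) / \<mu>\<close>. By orthogonality the integral of \<open>h\<^sup>2\<close>
  equals that of \<open>- h * w\<close>, and comparing the orders \<open>1 / \<mu>\<close> and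
  \<open>(\<mu>' - \<mu>) / (\<mu> * sqrt \<mu>)\<close> of the two sides bounds \<open>\<mu>' - \<mu>\<close> from below.
\<close>

lemma eigenvalue_gap:
  "\<exists>c>0. \<forall>\<mu> \<mu>'. 1 \<le> \<mu> \<and> \<mu> < \<mu>' \<and> SL_eigenvalue p q \<mu> \<and> SL_eigenvalue p q \<mu>' \<longrightarrow>
      c * sqrt \<mu> \<le> \<mu>' - \<mu>"
proof -
  define A where "A = exp rate / p 0"
  define B where "B = A / m * exp (rate + 1)"
  define e where "e = exp (- rate) / p 0 / (2 + Q)"
  have p0: "0 < p 0" by (rule p_pos) simp
  have A0: "0 < A" and B0: "0 < B" and e0: "0 < e"
    using p0 m_pos Q_nonneg by (auto simp: A_def B_def e_def intro!: divide_pos_pos)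
  have "e / sqrt (A * B) * sqrt \<mu> \<le> \<mu>' - \<mu>"
    if \<mu>: "1 \<le> \<mu>" and lt: "\<mu> < \<mu>'" and ev: "SL_eigenvalue p q \<mu>" "SL_eigenvalue p q \<mu>'" for \<mu> \<mu>'
  proof -
    have \<mu>': "1 \<le> \<mu>'" using \<mu> lt by simp
    define \<delta> where "\<delta> = \<mu>' - \<mu>"
    have \<delta>0: "0 < \<delta>" using lt by (simp add: \<delta>_def)
    obtain h u where h: "solves \<mu> (\<lambda>_. 0) h u" "h 0 = 0" "h 1 = 0" "u 0 = 1"
      by (rule normalised_eigenfunction[OF \<mu> ev(1)])
    obtain k v where k: "solves \<mu>' (\<lambda>_. 0) k v" "k 0 = 0" "k 1 = 0" "v 0 = 1"
      by (rule normalised_eigenfunction[OF \<mu>' ev(2)])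
    have hb: "\<mu> * (h x)\<^sup>2 \<le> A" if x: "x \<in> {0..1}" for x
    proof -
      have "0 \<le> (u x)\<^sup>2 / p x" using p_pos[OF x] by simp
      then have "\<mu> * (h x)\<^sup>2 \<le> energy \<mu> h u x" by (simp add: energy_def)
      also have "\<dots> \<le> A" using energy_upper[OF h(1) \<mu> x] h by (simp add: energy_def A_def)
      finally show ?thesis .
    qed
    have kb: "\<mu> * (k x)\<^sup>2 \<le> A" if x: "x \<in> {0..1}" for x
    proof -
      have "0 \<le> (v x)\<^sup>2 / p x" using p_pos[OF x] by simp
      moreover have "\<mu> * (k x)\<^sup>2 \<le> \<mu>' * (k x)\<^sup>2" using lt by (intro mult_right_mono) auto
      ultimately have "\<mu> * (k x)\<^sup>2 \<le> energy \<mu>' k v x" by (simp add: energy_def)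
      also have "\<dots> \<le> A" using energy_upper[OF k(1) \<mu>' x] k by (simp add: energy_def A_def)
      finally show ?thesis .
    qed
    let ?w = "\<lambda>x. k x - h x" and ?U = "\<lambda>x. v x - u x"
    have sw: "solves \<mu> (\<lambda>x. \<delta> * k x) ?w ?U"
      using h(1) k(1) unfolding solves_def
      by (auto intro!: derivative_eq_intros simp: \<delta>_def algebra_simps diff_divide_distrib)
    have wb: "\<mu> * (?w x)\<^sup>2 \<le> \<delta>\<^sup>2 * B / \<mu>" if x: "x \<in> {0..1}" for x
    proof -
      have F: "(\<delta> * k t)\<^sup>2 \<le> \<delta>\<^sup>2 * A / \<mu>" if "t \<in> {0..1}" for t
      proof -
        have "(k t)\<^sup>2 \<le> A / \<mu>" using kb[OF that] \<mu> by (simp add: field_simps)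
        from mult_left_mono[OF this, of "\<delta>\<^sup>2"] show ?thesis by (simp add: power_mult_distrib)
      qed
      have "0 \<le> (?U x)\<^sup>2 / p x" using p_pos[OF x] by simp
      then have "\<mu> * (?w x)\<^sup>2 \<le> energy \<mu> ?w ?U x" by (simp add: energy_def)
      also have "\<dots> \<le> \<delta>\<^sup>2 * A / \<mu> / m * exp (rate + 1)"
        by (rule energy_forced[OF sw \<mu> x F]) (use h k in auto)
      finally show ?thesis by (simp add: B_def mult_ac)
    qed
    have hw: "- (h x * ?w x) \<le> \<delta> * sqrt (A * B) / (\<mu> * sqrt \<mu>)" if x: "x \<in> {0..1}" for x
    proof -
      have "(\<mu> * (h x)\<^sup>2) * (\<mu> * (?w x)\<^sup>2) \<le> A * (\<delta>\<^sup>2 * B / \<mu>)"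
        using \<mu> A0 by (intro mult_mono hb wb x) auto
      then have "(h x * ?w x)\<^sup>2 * \<mu>\<^sup>2 \<le> \<delta>\<^sup>2 * (A * B) / \<mu>"
        by (simp add: power2_eq_square mult_ac)
      then have "(h x * ?w x)\<^sup>2 \<le> \<delta>\<^sup>2 * (A * B) / \<mu> / \<mu>\<^sup>2"
        using \<mu> by (subst pos_le_divide_eq) auto
      then have "sqrt ((h x * ?w x)\<^sup>2) \<le> sqrt (\<delta>\<^sup>2 * (A * B) / \<mu> / \<mu>\<^sup>2)"
        by (rule real_sqrt_le_mono)
      also have "\<dots> = \<delta> * sqrt (A * B) / (\<mu> * sqrt \<mu>)"
        using \<delta>0 \<mu> by (simp add: real_sqrt_mult real_sqrt_divide mult_ac)
      finally show ?thesis by (simp add: abs_le_iff)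
    qed
    have hc: "continuous_on {0..1} h" by (rule solves_cont[OF h(1)])
    have I2: "((\<lambda>x. (h x)\<^sup>2) has_integral integral {0..1} (\<lambda>x. (h x)\<^sup>2)) {0..1}"
      by (intro integrable_integral integrable_continuous_real continuous_intros hc)
    have "((\<lambda>x. (h x)\<^sup>2 - h x * k x) has_integral integral {0..1} (\<lambda>x. (h x)\<^sup>2) - 0) {0..1}"
      by (intro has_integral_diff I2 eigenfunctions_orthogonal[OF h(1-3) k(1-3)]) (use lt in auto)
    then have J: "((\<lambda>x. - (h x * ?w x)) has_integral integral {0..1} (\<lambda>x. (h x)\<^sup>2)) {0..1}"
      by (simp add: power2_eq_square algebra_simps)
    have const: "((\<lambda>x. \<delta> * sqrt (A * B) / (\<mu> * sqrt \<mu>)) has_integral \<delta> * sqrt (A * B) / (\<mu> * sqrt \<mu>)) {0..1::real}"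
      using has_integral_const_real[of "\<delta> * sqrt (A * B) / (\<mu> * sqrt \<mu>)" 0 1] by simp
    have "e / \<mu> \<le> integral {0..1} (\<lambda>x. (h x)\<^sup>2)"
      using eigenfunction_mass[OF h \<mu>] by (simp add: e_def)
    also have "\<dots> \<le> \<delta> * sqrt (A * B) / (\<mu> * sqrt \<mu>)"
      by (rule has_integral_le[OF J const hw])
    finally have "e / \<mu> * (\<mu> * sqrt \<mu>) \<le> \<delta> * sqrt (A * B)"
      using \<mu> by (subst (asm) pos_le_divide_eq) auto
    then have "e * sqrt \<mu> \<le> \<delta> * sqrt (A * B)" using \<mu> by simp
    then show ?thesis
      using A0 B0 by (simp add: \<delta>_def pos_divide_le_eq)
  qed
  moreover have "0 < e / sqrt (A * B)" using A0 B0 e0 by simp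
  ultimately show ?thesis by blast
qed

end

lemma SL_eigenvalue_gap:
  assumes "smooth_on_unit_interval p" "smooth_on_unit_interval q" "\<forall>x\<in>{0..1}. 0 < p x"
  shows "\<exists>c>0. \<forall>\<mu> \<mu>'. 1 \<le> \<mu> \<and> \<mu> < \<mu>' \<and> SL_eigenvalue p q \<mu> \<and> SL_eigenvalue p q \<mu>' \<longrightarrow>
      c * sqrt \<mu> \<le> \<mu>' - \<mu>"
proof -
  obtain p' where p': "continuous_on {0..1} p'"
    "\<And>x. x \<in> {0..1} \<Longrightarrow> (p has_real_derivative p' x) (at x within {0..1})"
    using smooth_on_unit_interval_C1[OF assms(1)] by metis
  obtain q' where "\<And>x. x \<in> {0..1} \<Longrightarrow> (q has_real_derivative q' x) (at x within {0..1})"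
    using smooth_on_unit_interval_C1[OF assms(2)] by metis
  then have qc: "continuous_on {0..1} q" by (rule DERIV_continuous_on)
  have pc: "continuous_on {0..1} p" by (rule DERIV_continuous_on[OF p'(2)])
  obtain x0 where x0: "x0 \<in> {0..1}" "\<And>x. x \<in> {0..1} \<Longrightarrow> p x0 \<le> p x"
    using continuous_attains_inf[OF _ _ pc] by auto
  have bdd: "\<exists>K. \<forall>x\<in>{0..1}. \<bar>f x\<bar> \<le> K" if "continuous_on {0..1} f" for f :: "real \<Rightarrow> real"
    using compact_imp_bounded[OF compact_continuous_image[OF that]]
    by (auto simp: bounded_iff)
  obtain P where P: "\<forall>x\<in>{0..1}. \<bar>p' x\<bar> \<le> P" using bdd[OF p'(1)] by blast
  obtain Q where Q: "\<forall>x\<in>{0..1}. \<bar>q x\<bar> \<le> Q" using bdd[OF qc] by blast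
  interpret SL_coefficients p p' q "p x0" P Q
    by unfold_locales (use p' qc assms(3) x0 P Q in auto)
  show ?thesis by (rule eigenvalue_gap)
qed

section \<open>From spectral gaps to quadratic separation\<close>

text \<open>
  From \<open>lam (Suc n) \<ge> lam n + c * sqrt (lam n)\<close> the square roots \<open>sqrt (lam n)\<close> increase by a fixed
  amount in each step once \<open>lam n \<ge> 1\<close>, hence they grow at least linearly, and the gap hypothesis
  turns this into a linear bound for the gaps. The finitely many gaps before that are positive by
  monotonicity.
\<close>

lemma consecutive_gaps_linear:
  fixes lam :: "nat \<Rightarrow> real"
  assumes mono: "strict_mono_on {1..} lam" and lim: "filterlim lam at_top sequentially"
    and c: "0 < c" and gap: "\<And>n. 1 \<le> n \<Longrightarrow> 1 \<le> lam n \<Longrightarrow> c * sqrt (lam n) \<le> lam (Suc n) - lam n"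
  shows "\<exists>\<kappa>>0. \<forall>n\<ge>1. \<kappa> * real n \<le> lam (Suc n) - lam n"
proof -
  have "eventually (\<lambda>n. 1 \<le> lam n) sequentially"
    using lim by (simp add: filterlim_at_top)
  then obtain n1 where n1: "\<And>n. n1 \<le> n \<Longrightarrow> 1 \<le> lam n"
    by (auto simp: eventually_sequentially)
  define n0 where "n0 = Suc n1"
  have n0: "1 \<le> lam n" if "n0 \<le> n" for n using n1 that by (simp add: n0_def)
  \<comment> \<open>Small enough for \<open>(s + a)\<^sup>2 \<le> s\<^sup>2 + c * s\<close> whenever \<open>1 \<le> s\<close>.\<close>
  define a where "a = min 1 (c / 3)"
  have a: "0 < a" "a \<le> 1" "3 * a \<le> c" using c by (auto simp: a_def)
  have grow: "a * real d \<le> sqrt (lam (n0 + d))" for d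
  proof (induction d)
    case 0
    then show ?case using n0[of n0] by simp
  next
    case (Suc d)
    define s where "s = sqrt (lam (n0 + d))"
    have s: "1 \<le> s" "s\<^sup>2 = lam (n0 + d)" using n0[of "n0 + d"] by (auto simp: s_def)
    have "a * a \<le> a * s" using a s by (intro mult_left_mono) auto
    moreover have "3 * a * s \<le> c * s" using a s by (intro mult_right_mono) auto
    ultimately have "(s + a)\<^sup>2 \<le> s\<^sup>2 + c * s"
      by (simp add: power2_eq_square algebra_simps)
    also have "\<dots> \<le> lam (n0 + Suc d)"
      using gap[of "n0 + d"] n0[of "n0 + d"] s(2) by (simp add: n0_def s_def)
    finally have "s + a \<le> sqrt (lam (n0 + Suc d))" by (rule real_le_rsqrt)
    then show ?case using Suc by (simp add: s_def algebra_simps)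
  qed
  \<comment> \<open>Beyond \<open>2 * n0\<close> the linear growth counted from \<open>n0\<close> is at least half of that counted from \<open>0\<close>.\<close>
  define G where "G = Min ((\<lambda>n. lam (Suc n) - lam n) ` {1..2 * n0})"
  have "0 < lam (Suc n) - lam n" if "1 \<le> n" for n
    using strict_mono_onD[OF mono, of n "Suc n"] that by simp
  then have G0: "0 < G" unfolding G_def by (subst Min_gr_iff) (auto simp: n0_def)
  have G: "G \<le> lam (Suc n) - lam n" if "1 \<le> n" "n \<le> 2 * n0" for n
    unfolding G_def using that by (intro Min_le) auto
  define \<kappa> where "\<kappa> = min (G / (2 * real n0)) (c * a / 2)"
  have "0 < \<kappa>" using G0 c a by (auto simp: \<kappa>_def n0_def)
  moreover have "\<kappa> * real n \<le> lam (Suc n) - lam n" if n: "1 \<le> n" for n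
  proof (cases "n \<le> 2 * n0")
    case True
    have "\<kappa> * real n \<le> G / (2 * real n0) * (2 * real n0)"
      using True G0 by (intro mult_mono) (auto simp: \<kappa>_def)
    also have "\<dots> = G" by (simp add: n0_def)
    finally show ?thesis using G[OF n True] by simp
  next
    case False
    have "a * (real n / 2) \<le> a * real (n - n0)"
      using False a by (intro mult_left_mono) auto
    also have "\<dots> \<le> sqrt (lam n)" using grow[of "n - n0"] False by simp
    finally have "c * (a * (real n / 2)) \<le> c * sqrt (lam n)" using c by (intro mult_left_mono) auto
    also have "\<dots> \<le> lam (Suc n) - lam n" using gap[OF n] n0[of n] False by simp
    finally have "c * a / 2 * real n \<le> lam (Suc n) - lam n" by simp
    moreover have "\<kappa> * real n \<le> c * a / 2 * real n" by (intro mult_right_mono) (auto simp: \<kappa>_def)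
    ultimately show ?thesis by simp
  qed
  ultimately show ?thesis by blast
qed

text \<open>
  The gap after \<open>n + d\<close> is at least \<open>\<kappa> * (n + d) \<ge> \<kappa> * (d + 1 / 2)\<close>, which is the increment of
  \<open>\<kappa> / 2 * d\<^sup>2\<close>.
\<close>

lemma quadratic_gap:
  fixes lam :: "nat \<Rightarrow> real"
  assumes gap: "\<And>n. 1 \<le> n \<Longrightarrow> \<kappa> * real n \<le> lam (Suc n) - lam n" and "0 < \<kappa>" and n: "1 \<le> n"
  shows "\<kappa> / 2 * (real d)\<^sup>2 \<le> lam (n + d) - lam n"
proof (induction d)
  case (Suc d)
  have "\<kappa> / 2 * (real (Suc d))\<^sup>2 = \<kappa> / 2 * (real d)\<^sup>2 + \<kappa> * (real d + 1 / 2)"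
    by (simp add: power2_eq_square algebra_simps)
  also have "\<kappa> * (real d + 1 / 2) \<le> \<kappa> * real (n + d)"
    using n \<open>0 < \<kappa>\<close> by (intro mult_left_mono) auto
  also have "\<dots> \<le> lam (Suc (n + d)) - lam (n + d)" using n by (intro gap) auto
  finally show ?case using Suc by simp
qed simp

text \<open>
  This sum is the exponent that the Lagrange polynomial of \<open>n\<close> gains at a neglected node; its
  cubic size is the source of all three decay rates.
\<close>

lemma cubic_tail_sum:
  fixes lam :: "nat \<Rightarrow> real"
  assumes gap: "\<And>d. \<kappa> / 2 * (real d)\<^sup>2 \<le> lam (n + d) - lam n" and "0 < \<kappa>"
  shows "\<kappa> / 6 * real d ^ 3 \<le> (\<Sum>j\<in>{n<..n + d}. lam j - lam n)"
proof (induction d)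
  case (Suc d)
  have "real (Suc d) ^ 3 \<le> real d ^ 3 + 3 * (real (Suc d))\<^sup>2"
    by (simp add: power2_eq_square power3_eq_cube algebra_simps)
  then have "\<kappa> / 6 * real (Suc d) ^ 3 \<le> \<kappa> / 6 * (real d ^ 3 + 3 * (real (Suc d))\<^sup>2)"
    using \<open>0 < \<kappa>\<close> by (intro mult_left_mono) auto
  also have "\<dots> = \<kappa> / 6 * real d ^ 3 + \<kappa> / 2 * (real (Suc d))\<^sup>2"
    by (simp add: algebra_simps)
  also have "\<dots> \<le> (\<Sum>j\<in>{n<..n + d}. lam j - lam n) + (lam (n + Suc d) - lam n)"
    by (intro add_mono Suc gap)
  also have "\<dots> = (\<Sum>j\<in>{n<..n + Suc d}. lam j - lam n)"
  proof -
    have "{n<..n + Suc d} = insert (n + Suc d) {n<..n + d}" by auto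
    then show ?thesis by simp
  qed
  finally show ?case .
qed simp

section \<open>Hermite interpolation and confluent Vandermonde systems\<close>

definition lagrange_poly :: "nat set \<Rightarrow> (nat \<Rightarrow> real) \<Rightarrow> nat \<Rightarrow> real poly" where
  "lagrange_poly S \<phi> n = (\<Prod>j\<in>S - {n}. smult (1 / (\<phi> n - \<phi> j)) [:- \<phi> j, 1:])"

text \<open>
  The Hermite basis polynomials on the double nodes \<open>\<phi> ` S\<close>: the first has derivative one at
  \<open>\<phi> n\<close>, the second has value one there, and all their other nodal values and nodal derivatives
  vanish.
\<close>

definition hermite_slope_poly :: "nat set \<Rightarrow> (nat \<Rightarrow> real) \<Rightarrow> nat \<Rightarrow> real poly" where
  "hermite_slope_poly S \<phi> n = [:- \<phi> n, 1:] * (lagrange_poly S \<phi> n)\<^sup>2"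

definition hermite_value_poly :: "nat set \<Rightarrow> (nat \<Rightarrow> real) \<Rightarrow> nat \<Rightarrow> real poly" where
  "hermite_value_poly S \<phi> n = (lagrange_poly S \<phi> n)\<^sup>2
     - smult (2 * poly (pderiv (lagrange_poly S \<phi> n)) (\<phi> n)) (hermite_slope_poly S \<phi> n)"

lemma poly_lagrange_poly:
  "poly (lagrange_poly S \<phi> n) x = (\<Prod>j\<in>S - {n}. (x - \<phi> j) / (\<phi> n - \<phi> j))"
  by (simp add: lagrange_poly_def poly_prod diff_divide_distrib)

lemma poly_hermite_slope_poly:
  "poly (hermite_slope_poly S \<phi> n) x = (x - \<phi> n) * (poly (lagrange_poly S \<phi> n) x)\<^sup>2"
  by (simp add: hermite_slope_poly_def algebra_simps)

context
  fixes S :: "nat set" and \<phi> :: "nat \<Rightarrow> real" and n :: nat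
  assumes fin: "finite S" and inj: "inj_on \<phi> S" and n: "n \<in> S"
begin

lemma poly_lagrange_poly_node:
  "j \<in> S \<Longrightarrow> poly (lagrange_poly S \<phi> n) (\<phi> j) = (if j = n then 1 else 0)"
  using fin inj n by (auto simp: poly_lagrange_poly inj_on_eq_iff intro!: prod.neutral)

lemma poly_pderiv_lagrange_poly_self:
  "poly (pderiv (lagrange_poly S \<phi> n)) (\<phi> n) = (\<Sum>j\<in>S - {n}. 1 / (\<phi> n - \<phi> j))"
proof -
  have "poly (\<Prod>i\<in>S - {n} - {j}. smult (1 / (\<phi> n - \<phi> i)) [:- \<phi> i, 1:]) (\<phi> n) = 1" for j
    using inj n
    by (auto simp: poly_prod inj_on_eq_iff diff_divide_distrib[symmetric] intro!: prod.neutral)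
  then show ?thesis
    by (simp add: lagrange_poly_def pderiv_prod poly_sum pderiv_smult pderiv_pCons)
qed

lemma degree_lagrange_poly: "degree (lagrange_poly S \<phi> n) \<le> card S - 1"
proof -
  have "degree (lagrange_poly S \<phi> n)
      \<le> sum (degree \<circ> (\<lambda>j. smult (1 / (\<phi> n - \<phi> j)) [:- \<phi> j, 1:])) (S - {n})"
    unfolding lagrange_poly_def by (rule degree_prod_sum_le) (use fin in auto)
  also have "\<dots> \<le> (\<Sum>j\<in>S - {n}. 1)"
    by (intro sum_mono) (auto simp: o_def)
  finally show ?thesis using fin n by simp
qed

lemma hermite_poly_degree:
  "degree (hermite_slope_poly S \<phi> n) < 2 * card S"
  "degree (hermite_value_poly S \<phi> n) < 2 * card S"
proof -
  have c: "0 < card S" using fin n by (auto simp: card_gt_0_iff)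
  have sq: "degree ((lagrange_poly S \<phi> n)\<^sup>2) \<le> 2 * (card S - 1)"
    using degree_power_le[of "lagrange_poly S \<phi> n" 2] degree_lagrange_poly by simp
  have "degree (hermite_slope_poly S \<phi> n) \<le> 1 + 2 * (card S - 1)"
    unfolding hermite_slope_poly_def
    using degree_mult_le[of "[:- \<phi> n, 1:]" "(lagrange_poly S \<phi> n)\<^sup>2"] sq by simp
  then show 1: "degree (hermite_slope_poly S \<phi> n) < 2 * card S" using c by simp
  show "degree (hermite_value_poly S \<phi> n) < 2 * card S"
    unfolding hermite_value_poly_def
    by (rule degree_diff_less) (use sq c 1 in \<open>auto intro: le_less_trans[OF degree_smult_le]\<close>)
qed

lemma hermite_poly_interpolation:
  assumes "j \<in> S"
  shows "poly (hermite_slope_poly S \<phi> n) (\<phi> j) = 0"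
    "poly (pderiv (hermite_slope_poly S \<phi> n)) (\<phi> j) = (if j = n then 1 else 0)"
    "poly (hermite_value_poly S \<phi> n) (\<phi> j) = (if j = n then 1 else 0)"
    "poly (pderiv (hermite_value_poly S \<phi> n)) (\<phi> j) = 0"
  using poly_lagrange_poly_node[OF assms]
  by (auto simp: hermite_slope_poly_def hermite_value_poly_def power2_eq_square
      pderiv_mult pderiv_diff pderiv_smult pderiv_pCons)

end

lemma poly_pderiv_altdef:
  fixes P :: "real poly"
  shows "poly (pderiv P) x = (\<Sum>i\<le>degree P. coeff P i * (real i * x ^ (i - 1)))"
proof -
  have "((\<lambda>x. \<Sum>i\<le>degree P. coeff P i * x ^ i) has_real_derivative
      (\<Sum>i\<le>degree P. coeff P i * (real i * x ^ (i - 1)))) (at x)"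
    by (auto intro!: derivative_eq_intros simp: mult_ac)
  then have "(poly P has_real_derivative (\<Sum>i\<le>degree P. coeff P i * (real i * x ^ (i - 1)))) (at x)"
    by (simp add: poly_altdef[abs_def])
  with poly_DERIV[of P x] show ?thesis by (rule DERIV_unique)
qed

text \<open>
  By linearity the equations for the monomials hold for every polynomial of degree less than
  twice the number of nodes: the left-hand side evaluates \<open>P\<close> and its derivative at the nodes in
  \<open>S\<close>, the right-hand side evaluates \<open>P\<close> at the nodes in \<open>T\<close>. A Hermite basis polynomial picks out
  a single unknown.
\<close>

lemma confluent_vandermonde_solution:
  fixes a b y \<phi> :: "nat \<Rightarrow> real"
  assumes fin: "finite S" and inj: "inj_on \<phi> S"
    and eq: "\<And>k. k < 2 * card S \<Longrightarrow>
      (\<Sum>j\<in>S. a j * \<phi> j ^ k + b j * (real k * \<phi> j ^ (k - 1))) = (\<Sum>m\<in>T. y m * \<phi> m ^ k)"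
    and n: "n \<in> S"
  shows "a n = (\<Sum>m\<in>T. y m * poly (hermite_value_poly S \<phi> n) (\<phi> m))"
    and "b n = (\<Sum>m\<in>T. y m * poly (hermite_slope_poly S \<phi> n) (\<phi> m))"
proof -
  have poly_eq: "(\<Sum>j\<in>S. a j * poly P (\<phi> j) + b j * poly (pderiv P) (\<phi> j)) = (\<Sum>m\<in>T. y m * poly P (\<phi> m))"
    if "degree P < 2 * card S" for P
  proof -
    have "(\<Sum>j\<in>S. a j * poly P (\<phi> j) + b j * poly (pderiv P) (\<phi> j))
        = (\<Sum>j\<in>S. \<Sum>k\<le>degree P. coeff P k * (a j * \<phi> j ^ k + b j * (real k * \<phi> j ^ (k - 1))))"
      by (simp add: poly_altdef[of P] poly_pderiv_altdef sum_distrib_left sum.distrib[symmetric] algebra_simps)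
    also have "\<dots> = (\<Sum>k\<le>degree P. coeff P k * (\<Sum>j\<in>S. a j * \<phi> j ^ k + b j * (real k * \<phi> j ^ (k - 1))))"
      by (subst sum.swap) (simp add: sum_distrib_left)
    also have "\<dots> = (\<Sum>k\<le>degree P. coeff P k * (\<Sum>m\<in>T. y m * \<phi> m ^ k))"
      by (intro sum.cong refl) (use eq that in auto)
    also have "\<dots> = (\<Sum>m\<in>T. y m * poly P (\<phi> m))"
      by (simp add: poly_altdef sum_distrib_left mult_ac) (subst sum.swap, simp)
    finally show ?thesis .
  qed
  have delta: "(\<Sum>j\<in>S. f j * (if j = n then 1 else 0)) = f n" for f :: "nat \<Rightarrow> real"
    using fin n by (simp add: if_distrib cong: if_cong)
  note H = hermite_poly_interpolation[OF fin inj n] hermite_poly_degree[OF fin inj n]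
  show "a n = (\<Sum>m\<in>T. y m * poly (hermite_value_poly S \<phi> n) (\<phi> m))"
    using poly_eq[OF H(6)] by (simp add: H(3,4) delta cong: sum.cong)
  show "b n = (\<Sum>m\<in>T. y m * poly (hermite_slope_poly S \<phi> n) (\<phi> m))"
    using poly_eq[OF H(5)] by (simp add: H(1,2) delta cong: sum.cong)
qed

section \<open>Condition numbers at exponential nodes\<close>

text \<open>
  The derivative at \<open>\<epsilon> = 0\<close> of the identity \<open>prony_residual = 0\<close>. The factor \<open>k\<close> coming from the
  exponents is written as \<open>k * \<phi> ^ k = \<phi> * (k * \<phi> ^ (k - 1))\<close>, so that the system takes the confluent
  Vandermonde form.
\<close>

lemma linearised_prony_system:
  assumes branch: "solution_branch N1 N2 \<Delta> lam y yh lamh" and k: "k < 2 * N1"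
  shows "(\<Sum>n=1..N1. condition_number yh n * exp (- lam n * \<Delta>) ^ k
      + (- \<Delta> * y n * exp (- lam n * \<Delta>) * condition_number lamh n) *
        (real k * exp (- lam n * \<Delta>) ^ (k - 1)))
    = (\<Sum>m=N1+1..N1+N2. y m * exp (- lam m * \<Delta>) ^ k)"
proof -
  obtain r where r: "r > 0"
    and C1: "\<And>n. n \<in> {1..N1} \<Longrightarrow> (\<lambda>\<epsilon>. yh \<epsilon> n) C1_differentiable_on {-r<..<r}"
      "\<And>n. n \<in> {1..N1} \<Longrightarrow> (\<lambda>\<epsilon>. lamh \<epsilon> n) C1_differentiable_on {-r<..<r}"
    and zero: "\<And>\<epsilon>. \<epsilon> \<in> {-r<..<r} \<Longrightarrow> prony_residual N1 N2 \<Delta> lam y (yh \<epsilon>) (lamh \<epsilon>) \<epsilon> k = 0"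
    and init: "\<And>n. n \<in> {1..N1} \<Longrightarrow> yh 0 n = y n" "\<And>n. n \<in> {1..N1} \<Longrightarrow> lamh 0 n = lam n"
    using branch k unfolding solution_branch_def by blast
  let ?Ky = "condition_number yh" and ?Kl = "condition_number lamh"
  have dy: "((\<lambda>\<epsilon>. yh \<epsilon> n) has_real_derivative ?Ky n) (at 0)" if "n \<in> {1..N1}" for n
    using C1(1)[OF that] r unfolding condition_number_def C1_differentiable_on_eq
    by (simp add: DERIV_deriv_iff_real_differentiable)
  have dl: "((\<lambda>\<epsilon>. lamh \<epsilon> n) has_real_derivative ?Kl n) (at 0)" if "n \<in> {1..N1}" for n
    using C1(2)[OF that] r unfolding condition_number_def C1_differentiable_on_eq
    by (simp add: DERIV_deriv_iff_real_differentiable)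
  have summand: "((\<lambda>\<epsilon>. yh \<epsilon> n * exp (- lamh \<epsilon> n * real k * \<Delta>)) has_real_derivative
      ?Ky n * exp (- lam n * real k * \<Delta>) - y n * (?Kl n * real k * \<Delta>) * exp (- lam n * real k * \<Delta>)) (at 0)"
    if "n \<in> {1..N1}" for n
    using init[OF that]
    by (auto intro!: derivative_eq_intros dy dl that simp: algebra_simps)
  have "((\<lambda>\<epsilon>. prony_residual N1 N2 \<Delta> lam y (yh \<epsilon>) (lamh \<epsilon>) \<epsilon> k) has_real_derivative
      (\<Sum>n=1..N1. ?Ky n * exp (- lam n * real k * \<Delta>) - y n * (?Kl n * real k * \<Delta>) * exp (- lam n * real k * \<Delta>))
      - 0 - 1 * (\<Sum>n=N1+1..N1+N2. y n * exp (- lam n * real k * \<Delta>))) (at 0)"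
    unfolding prony_residual_def
    by (intro DERIV_diff DERIV_sum summand DERIV_const DERIV_cmult_right DERIV_ident)
  moreover have "((\<lambda>\<epsilon>. prony_residual N1 N2 \<Delta> lam y (yh \<epsilon>) (lamh \<epsilon>) \<epsilon> k) has_real_derivative 0) (at 0)"
    by (rule has_field_derivative_transform_within_open[of "\<lambda>_. 0" 0 0 "{-r<..<r}"])
      (use r zero in auto)
  ultimately have eq: "(\<Sum>n=1..N1. ?Ky n * exp (- lam n * real k * \<Delta>) - y n * (?Kl n * real k * \<Delta>) * exp (- lam n * real k * \<Delta>))
      = (\<Sum>n=N1+1..N1+N2. y n * exp (- lam n * real k * \<Delta>))"
    by (auto dest: DERIV_unique)
  have pow: "exp (- lam n * real k * \<Delta>) = exp (- lam n * \<Delta>) ^ k" for n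
    by (simp add: exp_of_nat_mult[symmetric] mult_ac)
  have shift: "real k * exp (- lam n * \<Delta>) ^ k = exp (- lam n * \<Delta>) * (real k * exp (- lam n * \<Delta>) ^ (k - 1))" for n
    by (cases k) simp_all
  have conv: "?Ky n * exp (- lam n * real k * \<Delta>) - y n * (?Kl n * real k * \<Delta>) * exp (- lam n * real k * \<Delta>)
    = ?Ky n * exp (- lam n * \<Delta>) ^ k
      + (- \<Delta> * y n * exp (- lam n * \<Delta>) * ?Kl n) * (real k * exp (- lam n * \<Delta>) ^ (k - 1))" for n
    unfolding pow using shift[of n] by (auto simp: algebra_simps)
  show ?thesis using eq unfolding conv unfolding pow .
qed

text \<open>
  The price for replacing a difference of two nodes by the larger one of them, when the exponents
  are at least \<open>\<kappa>\<close> apart.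
\<close>

definition inv_gap :: "real \<Rightarrow> real \<Rightarrow> real" where
  "inv_gap \<kappa> \<Delta> = 1 / (1 - exp (- \<kappa> * \<Delta>))"

lemma inv_gap_ge_1: "0 < \<kappa> \<Longrightarrow> 0 < \<Delta> \<Longrightarrow> 1 \<le> inv_gap \<kappa> \<Delta>"
  by (simp add: inv_gap_def field_simps)

lemma node_gap:
  assumes "\<kappa> \<le> \<nu> - \<mu>" "0 < \<kappa>" "0 < \<Delta>"
  shows "exp (- \<nu> * \<Delta>) < exp (- \<mu> * \<Delta>)"
    and "exp (- \<mu> * \<Delta>) / (exp (- \<mu> * \<Delta>) - exp (- \<nu> * \<Delta>)) \<le> inv_gap \<kappa> \<Delta>"
    and "exp (- \<nu> * \<Delta>) / (exp (- \<mu> * \<Delta>) - exp (- \<nu> * \<Delta>)) \<le> inv_gap \<kappa> \<Delta> * exp (- \<Delta> * (\<nu> - \<mu>))"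
proof -
  show lt: "exp (- \<nu> * \<Delta>) < exp (- \<mu> * \<Delta>)" using assms by simp
  have eq: "exp (- \<nu> * \<Delta>) = exp (- \<mu> * \<Delta>) * exp (- \<Delta> * (\<nu> - \<mu>))"
    by (simp add: exp_add[symmetric] algebra_simps)
  have "exp (- \<Delta> * (\<nu> - \<mu>)) \<le> exp (- \<kappa> * \<Delta>)"
    using assms by (simp add: mult.commute)
  moreover have "exp (- \<kappa> * \<Delta>) < 1" using assms by simp
  ultimately have le: "1 / (1 - exp (- \<Delta> * (\<nu> - \<mu>))) \<le> inv_gap \<kappa> \<Delta>"
    unfolding inv_gap_def by (intro divide_left_mono mult_pos_pos) auto
  have r: "exp (- \<mu> * \<Delta>) / (exp (- \<mu> * \<Delta>) - exp (- \<nu> * \<Delta>)) = 1 / (1 - exp (- \<Delta> * (\<nu> - \<mu>)))"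
  proof -
    have "exp (- \<mu> * \<Delta>) - exp (- \<nu> * \<Delta>) = exp (- \<mu> * \<Delta>) * (1 - exp (- \<Delta> * (\<nu> - \<mu>)))"
      unfolding eq by (simp only: right_diff_distrib mult_1_right)
    then show ?thesis by simp
  qed
  show 2: "exp (- \<mu> * \<Delta>) / (exp (- \<mu> * \<Delta>) - exp (- \<nu> * \<Delta>)) \<le> inv_gap \<kappa> \<Delta>"
    unfolding r by (rule le)
  have "exp (- \<nu> * \<Delta>) / (exp (- \<mu> * \<Delta>) - exp (- \<nu> * \<Delta>))
    = exp (- \<mu> * \<Delta>) / (exp (- \<mu> * \<Delta>) - exp (- \<nu> * \<Delta>)) * exp (- \<Delta> * (\<nu> - \<mu>))"
    by (subst (1) eq) simp
  then show "exp (- \<nu> * \<Delta>) / (exp (- \<mu> * \<Delta>) - exp (- \<nu> * \<Delta>)) \<le> inv_gap \<kappa> \<Delta> * exp (- \<Delta> * (\<nu> - \<mu>))"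
    by (simp only:) (rule mult_right_mono[OF 2], simp)
qed

context
  fixes lam :: "nat \<Rightarrow> real" and \<kappa> \<Delta> :: real
  assumes sep: "\<And>i j. 1 \<le> i \<Longrightarrow> i < j \<Longrightarrow> \<kappa> \<le> lam j - lam i"
    and \<kappa>: "0 < \<kappa>" and \<Delta>: "0 < \<Delta>"
begin

abbreviation node :: "nat \<Rightarrow> real" where "node n \<equiv> exp (- lam n * \<Delta>)"

lemma inj_on_node: "inj_on node {1..N}"
proof (rule linorder_inj_onI)
  fix i j assume "i < j" "i \<in> {1..N}"
  then have "node j < node i" by (intro node_gap(1)[OF sep[of i j] \<kappa> \<Delta>]) auto
  then show "node i \<noteq> node j" by linarith
qed auto

text \<open>
  In the factor for \<open>j\<close> the numerator is at most \<open>node j\<close>, because the neglected node is the smallest.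
  The denominator is the larger one of \<open>node j\<close> and \<open>node n\<close> up to \<open>inv_gap\<close>, so a factor with
  \<open>j > n\<close> contributes the quotient \<open>node j / node n\<close>.
\<close>

lemma lagrange_poly_truncated_node:
  assumes n: "n \<in> {1..N}" and m: "N < m"
  shows "\<bar>poly (lagrange_poly {1..N} node n) (node m)\<bar>
    \<le> inv_gap \<kappa> \<Delta> ^ N * exp (- \<Delta> * (\<Sum>j\<in>{n<..N}. lam j - lam n))"
proof -
  let ?D = "inv_gap \<kappa> \<Delta>"
  let ?g = "\<lambda>j. if n < j then exp (- \<Delta> * (lam j - lam n)) else 1"
  have D: "1 \<le> ?D" by (rule inv_gap_ge_1[OF \<kappa> \<Delta>])
  have factor: "\<bar>(node m - node j) / (node n - node j)\<bar> \<le> ?D * ?g j" if j: "j \<in> {1..N} - {n}" for j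
  proof -
    have mj: "node m < node j" using node_gap(1)[OF sep[of j m] \<kappa> \<Delta>] j m by auto
    have num: "\<bar>node m - node j\<bar> \<le> node j" using mj by (simp add: abs_if)
    show ?thesis
    proof (cases "n < j")
      case True
      note gap = node_gap[OF sep[of n j] \<kappa> \<Delta>]
      have "\<bar>(node m - node j) / (node n - node j)\<bar> \<le> node j / (node n - node j)"
        using num gap(1) True n by (simp add: abs_divide divide_right_mono)
      also have "\<dots> \<le> ?D * exp (- \<Delta> * (lam j - lam n))"
        using gap(3) True n by simp
      finally show ?thesis using True by simp
    next
      case False
      then have jn: "1 \<le> j" "j < n" using j by auto
      note gap = node_gap[OF sep[OF jn] \<kappa> \<Delta>]
      have "\<bar>(node m - node j) / (node n - node j)\<bar> \<le> node j / (node j - node n)"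
        using num gap(1) by (simp add: abs_divide divide_right_mono)
      also have "\<dots> \<le> ?D" by (rule gap(2))
      finally show ?thesis using False by simp
    qed
  qed
  have "\<bar>poly (lagrange_poly {1..N} node n) (node m)\<bar>
      = (\<Prod>j\<in>{1..N} - {n}. \<bar>(node m - node j) / (node n - node j)\<bar>)"
    by (simp add: poly_lagrange_poly abs_prod)
  also have "\<dots> \<le> (\<Prod>j\<in>{1..N} - {n}. ?D * ?g j)"
    by (intro prod_mono conjI factor) auto
  also have "\<dots> = ?D ^ (N - 1) * (\<Prod>j\<in>{1..N} - {n}. ?g j)"
    using n by (simp add: prod.distrib)
  also have "(\<Prod>j\<in>{1..N} - {n}. ?g j) = (\<Prod>j\<in>{n<..N}. exp (- \<Delta> * (lam j - lam n)))"
    using n by (intro prod.mono_neutral_cong_right) auto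
  also have "\<dots> = exp (- \<Delta> * (\<Sum>j\<in>{n<..N}. lam j - lam n))"
    by (simp add: exp_sum[symmetric] sum_distrib_left sum_negf)
  also have "?D ^ (N - 1) * \<dots> \<le> ?D ^ N * \<dots>"
    using D by (intro mult_right_mono power_increasing) auto
  finally show ?thesis .
qed

text \<open>
  The derivative is the sum of the reciprocal node differences. The weight \<open>node n\<close>, which the
  Hermite polynomial supplies, makes each of these scale invariant and bounded by \<open>inv_gap\<close>.
\<close>

lemma pderiv_lagrange_poly_node:
  assumes n: "n \<in> {1..N}"
  shows "node n * \<bar>poly (pderiv (lagrange_poly {1..N} node n)) (node n)\<bar> \<le> real N * inv_gap \<kappa> \<Delta>"
proof -
  let ?D = "inv_gap \<kappa> \<Delta>"
  have D: "1 \<le> ?D" by (rule inv_gap_ge_1[OF \<kappa> \<Delta>])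
  have summand: "node n * \<bar>1 / (node n - node j)\<bar> \<le> ?D" if j: "j \<in> {1..N} - {n}" for j
  proof (cases "n < j")
    case True
    then show ?thesis using node_gap(1,2)[OF sep[of n j] \<kappa> \<Delta>] n by (simp add: abs_if)
  next
    case False
    then have jn: "1 \<le> j" "j < n" using j by auto
    note gap = node_gap[OF sep[OF jn] \<kappa> \<Delta>]
    have "\<bar>node n - node j\<bar> = node j - node n" using gap(1) by linarith
    then have "node n * \<bar>1 / (node n - node j)\<bar> = node n / (node j - node n)"
      by (simp only: abs_divide) simp
    also have "\<dots> \<le> node j / (node j - node n)"
      using gap(1) by (intro divide_right_mono) auto
    also have "\<dots> \<le> ?D" by (rule gap(2))
    finally show ?thesis .
  qed
  have "node n * \<bar>poly (pderiv (lagrange_poly {1..N} node n)) (node n)\<bar>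
      \<le> node n * (\<Sum>j\<in>{1..N} - {n}. \<bar>1 / (node n - node j)\<bar>)"
    unfolding poly_pderiv_lagrange_poly_self[OF finite_atLeastAtMost inj_on_node n]
    by (intro mult_left_mono sum_abs exp_ge_zero)
  also have "\<dots> \<le> (\<Sum>j\<in>{1..N} - {n}. ?D)"
    unfolding sum_distrib_left by (intro sum_mono summand)
  also have "\<dots> \<le> real N * ?D"
    using n D by (simp add: mult_right_mono)
  finally show ?thesis .
qed

lemma hermite_polys_truncated_node:
  assumes n: "n \<in> {1..N}" and m: "N < m"
  defines "B \<equiv> inv_gap \<kappa> \<Delta> ^ (2 * N) * exp (- 2 * \<Delta> * (\<Sum>j\<in>{n<..N}. lam j - lam n))"
  shows "\<bar>poly (hermite_slope_poly {1..N} node n) (node m)\<bar> \<le> node n * B"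
    and "\<bar>poly (hermite_value_poly {1..N} node n) (node m)\<bar> \<le> (1 + 2 * real N * inv_gap \<kappa> \<Delta>) * B"
proof -
  let ?L = "lagrange_poly {1..N} node n"
  have mn: "node m < node n" using node_gap(1)[OF sep[of n m] \<kappa> \<Delta>] n m by auto
  have sq: "(poly ?L (node m))\<^sup>2 \<le> B"
  proof -
    have "(poly ?L (node m))\<^sup>2 = \<bar>poly ?L (node m)\<bar>\<^sup>2" by simp
    also have "\<dots> \<le> (inv_gap \<kappa> \<Delta> ^ N * exp (- \<Delta> * (\<Sum>j\<in>{n<..N}. lam j - lam n)))\<^sup>2"
      by (rule power_mono[OF lagrange_poly_truncated_node[OF n m]]) simp
    also have "\<dots> = B"
      by (simp add: B_def power_mult_distrib power_even_eq exp_double[symmetric] mult.assoc)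
    finally show ?thesis .
  qed
  have diff: "\<bar>node m - node n\<bar> \<le> node n" using mn by (simp add: abs_if)
  have "\<bar>poly (hermite_slope_poly {1..N} node n) (node m)\<bar> = \<bar>node m - node n\<bar> * (poly ?L (node m))\<^sup>2"
    by (simp add: poly_hermite_slope_poly abs_mult)
  also have "\<dots> \<le> node n * B"
    by (intro mult_mono diff sq) auto
  finally show slope: "\<bar>poly (hermite_slope_poly {1..N} node n) (node m)\<bar> \<le> node n * B" .
  let ?s = "poly (pderiv ?L) (node n)"
  have B0: "0 \<le> B" using sq by (rule order_trans[rotated]) simp
  have "\<bar>poly (hermite_value_poly {1..N} node n) (node m)\<bar>
      \<le> (poly ?L (node m))\<^sup>2 + 2 * \<bar>?s\<bar> * \<bar>poly (hermite_slope_poly {1..N} node n) (node m)\<bar>"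
    using abs_triangle_ineq4[of "(poly ?L (node m))\<^sup>2" "2 * ?s * poly (hermite_slope_poly {1..N} node n) (node m)"]
    by (simp add: hermite_value_poly_def abs_mult)
  also have "\<dots> \<le> B + 2 * \<bar>?s\<bar> * (node n * B)"
    by (intro add_mono sq mult_left_mono slope) auto
  also have "\<dots> = (1 + 2 * (node n * \<bar>?s\<bar>)) * B" by (simp add: algebra_simps)
  also have "\<dots> \<le> (1 + 2 * (real N * inv_gap \<kappa> \<Delta>)) * B"
    using pderiv_lagrange_poly_node[OF n] B0 by (intro mult_right_mono) auto
  finally show "\<bar>poly (hermite_value_poly {1..N} node n) (node m)\<bar> \<le> (1 + 2 * real N * inv_gap \<kappa> \<Delta>) * B"
    by (simp add: mult.assoc)
qed

text \<open>
  The neglected amplitudes are at most \<open>M * \<bar>y n\<bar>\<close>, and the slope polynomial carries a factor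
  \<open>node n\<close>. In the equation for the exponents, both cancel against the coefficient
  \<open>\<Delta> * y n * node n\<close> of the unknown, and only \<open>1 / \<Delta>\<close> is left.
\<close>

lemma condition_number_bound:
  assumes l: "1 < l" and M: "0 < M"
    and adm: "admissible_amplitudes l M N1 N2 y"
    and branch: "solution_branch N1 N2 \<Delta> lam y yh lamh"
    and n: "n \<in> {1..N1}"
  defines "B \<equiv> inv_gap \<kappa> \<Delta> ^ (2 * N1) * exp (- 2 * \<Delta> * (\<Sum>j\<in>{n<..N1}. lam j - lam n))"
  shows "\<bar>condition_number yh n\<bar> \<le> real N2 * (M * l) * ((1 + 2 * real N1 * inv_gap \<kappa> \<Delta>) * B)"
    and "\<bar>condition_number lamh n\<bar> \<le> real N2 * M / \<Delta> * B"
proof -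
  have yn: "\<bar>y n\<bar> \<le> l" and "inverse l \<le> \<bar>y n\<bar>"
    using adm n by (auto simp: admissible_amplitudes_def)
  then have yn0: "0 < \<bar>y n\<bar>" using l less_le_trans[of 0 "inverse l" "\<bar>y n\<bar>"] by simp
  have ym: "\<bar>y m\<bar> \<le> M * \<bar>y n\<bar>" if "m \<in> {N1+1..N1+N2}" for m
  proof -
    have "\<bar>y m\<bar> / \<bar>y n\<bar> \<le> M" using adm n that by (simp add: admissible_amplitudes_def)
    then show ?thesis using yn0 by (simp add: pos_divide_le_eq)
  qed
  have system: "(\<Sum>n=1..N1. condition_number yh n * node n ^ k
      + (- \<Delta> * y n * node n * condition_number lamh n) * (real k * node n ^ (k - 1)))
    = (\<Sum>m=N1+1..N1+N2. y m * node m ^ k)" if "k < 2 * card {1..N1}" for k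
    using linearised_prony_system[OF branch, of k] that by simp
  note sol = confluent_vandermonde_solution[where S = "{1..N1}" and \<phi> = node and y = y
      and a = "condition_number yh" and b = "\<lambda>n. - \<Delta> * y n * node n * condition_number lamh n"
      and T = "{N1+1..N1+N2}", OF finite_atLeastAtMost inj_on_node _ n]
  have amplitude: "condition_number yh n = (\<Sum>m=N1+1..N1+N2. y m * poly (hermite_value_poly {1..N1} node n) (node m))"
    by (rule sol(1)) (rule system)
  have slope: "- \<Delta> * y n * node n * condition_number lamh n
      = (\<Sum>m=N1+1..N1+N2. y m * poly (hermite_slope_poly {1..N1} node n) (node m))"
    by (rule sol(2)) (rule system)
  have sum_bound: "\<bar>\<Sum>m=N1+1..N1+N2. y m * f m\<bar> \<le> real N2 * (M * \<bar>y n\<bar>) * K"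
    if f: "\<And>m. N1 < m \<Longrightarrow> \<bar>f m\<bar> \<le> K" for f :: "nat \<Rightarrow> real" and K
  proof -
    have "\<bar>\<Sum>m=N1+1..N1+N2. y m * f m\<bar> \<le> (\<Sum>m=N1+1..N1+N2. \<bar>y m\<bar> * \<bar>f m\<bar>)"
      by (rule order_trans[OF sum_abs]) (simp add: abs_mult)
    also have "\<dots> \<le> (\<Sum>m=N1+1..N1+N2. M * \<bar>y n\<bar> * K)"
      by (intro sum_mono mult_mono ym f) (use M in auto)
    finally show ?thesis by simp
  qed
  have B0: "0 \<le> B" using inv_gap_ge_1[OF \<kappa> \<Delta>] by (simp add: B_def)
  have D1: "0 \<le> inv_gap \<kappa> \<Delta>" using inv_gap_ge_1[OF \<kappa> \<Delta>] by simp
  have "\<bar>condition_number yh n\<bar> \<le> real N2 * (M * \<bar>y n\<bar>) * ((1 + 2 * real N1 * inv_gap \<kappa> \<Delta>) * B)"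
    unfolding amplitude B_def by (rule sum_bound) (rule hermite_polys_truncated_node[OF n])
  also have "\<dots> \<le> real N2 * (M * l) * ((1 + 2 * real N1 * inv_gap \<kappa> \<Delta>) * B)"
    using yn M B0 D1 by (intro mult_right_mono mult_left_mono) auto
  finally show "\<bar>condition_number yh n\<bar> \<le> real N2 * (M * l) * ((1 + 2 * real N1 * inv_gap \<kappa> \<Delta>) * B)" .
  have "\<bar>- \<Delta> * y n * node n * condition_number lamh n\<bar> \<le> real N2 * (M * \<bar>y n\<bar>) * (node n * B)"
    unfolding slope B_def by (rule sum_bound) (rule hermite_polys_truncated_node[OF n])
  then have "(\<Delta> * \<bar>condition_number lamh n\<bar>) * (\<bar>y n\<bar> * node n) \<le> (real N2 * M * B) * (\<bar>y n\<bar> * node n)"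
    using \<Delta> by (simp add: abs_mult mult_ac)
  then have "\<Delta> * \<bar>condition_number lamh n\<bar> \<le> real N2 * M * B"
    using yn0 by (subst (asm) mult_le_cancel_right_pos) auto
  then show "\<bar>condition_number lamh n\<bar> \<le> real N2 * M / \<Delta> * B"
    using \<Delta> by (simp add: pos_le_divide_eq mult.commute)
qed

end

section \<open>Maximal condition numbers in the three regimes\<close>

lemma max_condition_le:
  assumes "1 \<le> \<eta> * real N"
    and "\<And>n. 1 \<le> n \<Longrightarrow> real n \<le> \<eta> * real N \<Longrightarrow> \<bar>condition_number X n\<bar> \<le> K"
  shows "max_condition \<eta> N X \<le> K"
proof -
  have "1 \<le> \<lfloor>\<eta> * real N\<rfloor>" using assms(1) by (simp add: le_floor_iff)
  then show ?thesis
    unfolding max_condition_def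
    by (subst Max_le_iff) (auto intro!: assms(2) simp: le_nat_iff le_floor_iff)
qed

text \<open>
  The loss caused by the nearness of the retained nodes to each other. It depends on the spectrum
  only through the gap \<open>\<kappa>\<close> and has to be beaten by the gain \<open>exp (- 2 * c * \<Delta> * N ^ 3)\<close>.
\<close>

definition amplification :: "real \<Rightarrow> real \<Rightarrow> nat \<Rightarrow> real" where
  "amplification \<kappa> \<Delta> N = (1 + 2 * real N * inv_gap \<kappa> \<Delta>) * inv_gap \<kappa> \<Delta> ^ (2 * N)"

text \<open>
  The estimate from which the three regimes follow. For \<open>n \<le> \<eta> * N1\<close> at least
  \<open>(1 - \<eta>) * N1\<close> indices lie above \<open>n\<close>, so the exponent gained is at least a multiple of \<open>N1 ^ 3\<close>,
  with constants that depend neither on \<open>N1\<close> nor on \<open>\<Delta>\<close>.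
\<close>

lemma max_condition_bound:
  fixes lam :: "nat \<Rightarrow> real"
  assumes "0 < \<kappa>0" and gap: "\<And>n. 1 \<le> n \<Longrightarrow> \<kappa>0 * real n \<le> lam (Suc n) - lam n"
    and l: "1 < l" and M: "0 < M" and \<eta>: "0 < \<eta>" "\<eta> < 1"
  obtains \<kappa> c A where "0 < \<kappa>" "0 < c" "0 < A"
    "\<And>N1 \<Delta> y yh lamh. \<lbrakk>0 < \<Delta>; 1 \<le> \<eta> * real N1; admissible_amplitudes l M N1 N2 y;
        solution_branch N1 N2 \<Delta> lam y yh lamh\<rbrakk> \<Longrightarrow>
      max_condition \<eta> N1 yh \<le> A * (amplification \<kappa> \<Delta> N1 * exp (- 2 * c * \<Delta> * real N1 ^ 3)) \<and>
      max_condition \<eta> N1 lamh \<le> A / \<Delta> * (amplification \<kappa> \<Delta> N1 * exp (- 2 * c * \<Delta> * real N1 ^ 3))"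
proof
  define \<kappa> where "\<kappa> = \<kappa>0 / 2"
  define c where "c = \<kappa>0 / 6 * (1 - \<eta>) ^ 3"
  \<comment> \<open>The summand one keeps the constant positive when \<open>N2 = 0\<close>.\<close>
  define A where "A = real N2 * (M * l) + 1"
  show \<kappa>: "0 < \<kappa>" using assms by (simp add: \<kappa>_def)
  show "0 < c" using assms by (simp add: c_def)
  show "0 < A" using assms by (simp add: A_def add_nonneg_pos)
  have quad: "\<kappa>0 / 2 * (real d)\<^sup>2 \<le> lam (n + d) - lam n" if "1 \<le> n" for n d
    by (rule quadratic_gap[OF _ \<open>0 < \<kappa>0\<close> that]) (rule gap)
  have sep: "\<kappa> \<le> lam j - lam i" if "1 \<le> i" "i < j" for i j
  proof -
    have "1 \<le> (real (j - i))\<^sup>2" using that by simp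
    then have "\<kappa> * 1 \<le> \<kappa> * (real (j - i))\<^sup>2" using \<kappa> by (intro mult_left_mono) auto
    also have "\<dots> \<le> lam j - lam i" using quad[OF that(1), of "j - i"] that by (simp add: \<kappa>_def)
    finally show ?thesis by simp
  qed
  fix N1 :: nat and \<Delta> y yh lamh
  assume \<Delta>: "0 < \<Delta>" and N: "1 \<le> \<eta> * real N1" and adm: "admissible_amplitudes l M N1 N2 y"
    and branch: "solution_branch N1 N2 \<Delta> lam y yh lamh"
  let ?D = "inv_gap \<kappa> \<Delta>" and ?E = "exp (- 2 * c * \<Delta> * real N1 ^ 3)"
  have D1: "1 \<le> ?D" by (rule inv_gap_ge_1[OF \<kappa> \<Delta>])
  have tail: "n \<in> {1..N1} \<and> ?D ^ (2 * N1) * exp (- 2 * \<Delta> * (\<Sum>j\<in>{n<..N1}. lam j - lam n)) \<le> ?D ^ (2 * N1) * ?E"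
    if n: "1 \<le> n" "real n \<le> \<eta> * real N1" for n
  proof -
    have "\<eta> * real N1 \<le> 1 * real N1" using \<eta> by (intro mult_right_mono) auto
    then have le: "n \<le> N1" using n by simp
    have "((1 - \<eta>) * real N1) ^ 3 \<le> real (N1 - n) ^ 3"
      using n le \<eta> by (intro power_mono) (auto simp: of_nat_diff algebra_simps)
    then have "c * real N1 ^ 3 \<le> \<kappa>0 / 6 * real (N1 - n) ^ 3"
      using \<open>0 < \<kappa>0\<close> by (simp add: c_def power_mult_distrib)
    also have "\<dots> \<le> (\<Sum>j\<in>{n<..N1}. lam j - lam n)"
      using cubic_tail_sum[OF quad[OF n(1)] \<open>0 < \<kappa>0\<close>, of "N1 - n"] le by simp
    finally have "2 * \<Delta> * (c * real N1 ^ 3) \<le> 2 * \<Delta> * (\<Sum>j\<in>{n<..N1}. lam j - lam n)"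
      using \<Delta> by (intro mult_left_mono) auto
    then have "exp (- 2 * \<Delta> * (\<Sum>j\<in>{n<..N1}. lam j - lam n)) \<le> ?E"
      by (simp add: mult_ac)
    then show ?thesis using D1 n le by (auto intro!: mult_left_mono)
  qed
  have E0: "0 \<le> ?D ^ (2 * N1) * ?E" using D1 by simp
  have "max_condition \<eta> N1 yh \<le> A * (amplification \<kappa> \<Delta> N1 * ?E)"
  proof (rule max_condition_le[OF N])
    fix n :: nat assume n: "1 \<le> n" "real n \<le> \<eta> * real N1"
    have "\<bar>condition_number yh n\<bar> \<le> real N2 * (M * l) * ((1 + 2 * real N1 * ?D) * 
       (?D ^ (2 * N1) * exp (- 2 * \<Delta> * (\<Sum>j\<in>{n<..N1}. lam j - lam n))))"
      by (rule condition_number_bound(1)[OF _ \<kappa> \<Delta> l M adm branch]) (use sep tail[OF n] in auto)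
    also have "\<dots> \<le> A * ((1 + 2 * real N1 * ?D) * (?D ^ (2 * N1) * ?E))"
      using tail[OF n] D1 l M by (intro mult_mono) (auto simp: A_def)
    finally show "\<bar>condition_number yh n\<bar> \<le> A * (amplification \<kappa> \<Delta> N1 * ?E)"
      by (simp add: amplification_def mult.assoc)
  qed
  moreover have "max_condition \<eta> N1 lamh \<le> A / \<Delta> * (amplification \<kappa> \<Delta> N1 * ?E)"
  proof (rule max_condition_le[OF N])
    fix n :: nat assume n: "1 \<le> n" "real n \<le> \<eta> * real N1"
    have "real N2 * M * 1 \<le> real N2 * M * l" using l M by (intro mult_left_mono) auto
    then have A: "real N2 * M \<le> A" by (simp add: A_def mult.assoc)
    have "\<bar>condition_number lamh n\<bar> \<le> real N2 * M / \<Delta> *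
       (?D ^ (2 * N1) * exp (- 2 * \<Delta> * (\<Sum>j\<in>{n<..N1}. lam j - lam n)))"
      by (rule condition_number_bound(2)[OF _ \<kappa> \<Delta> l M adm branch]) (use sep tail[OF n] in auto)
    also have "\<dots> \<le> A / \<Delta> * (1 * (?D ^ (2 * N1) * ?E))"
      by (rule mult_mono) (use tail[OF n] D1 A \<Delta> \<open>0 < A\<close> in \<open>auto intro: divide_right_mono\<close>)
    also have "\<dots> \<le> A / \<Delta> * ((1 + 2 * real N1 * ?D) * (?D ^ (2 * N1) * ?E))"
      using \<Delta> \<open>0 < A\<close> D1 E0 by (intro mult_left_mono mult_right_mono) auto
    finally show "\<bar>condition_number lamh n\<bar> \<le> A / \<Delta> * (amplification \<kappa> \<Delta> N1 * ?E)"
      by (simp add: amplification_def mult.assoc)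
  qed
  ultimately show "max_condition \<eta> N1 yh \<le> A * (amplification \<kappa> \<Delta> N1 * ?E) \<and>
      max_condition \<eta> N1 lamh \<le> A / \<Delta> * (amplification \<kappa> \<Delta> N1 * ?E)" ..
qed

lemma amplification_nonneg: "0 < \<kappa> \<Longrightarrow> 0 < \<Delta> \<Longrightarrow> 0 \<le> amplification \<kappa> \<Delta> N"
  using inv_gap_ge_1[of \<kappa> \<Delta>] by (simp add: amplification_def)

text \<open>
  With \<open>\<Delta>\<close> fixed the loss is only exponential in \<open>N\<close>, up to a linear factor.
\<close>

lemma amplification_fixed_step:
  assumes "0 < \<kappa>" "0 < \<Delta>" "0 < b"
  shows "\<forall>\<^sub>F N in sequentially. amplification \<kappa> \<Delta> N * exp (- b * real N ^ 3) \<le> 1"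
proof -
  define D where "D = inv_gap \<kappa> \<Delta>"
  have D: "1 \<le> D" unfolding D_def by (rule inv_gap_ge_1) fact+
  then have D0: "0 < D" by simp
  have "((\<lambda>N. (1 + 2 * real N * D) * exp (2 * real N * D) * exp (- b * real N ^ 3)) \<longlongrightarrow> 0) sequentially"
    using D0 \<open>0 < b\<close> by real_asymp
  then have "\<forall>\<^sub>F N in sequentially. (1 + 2 * real N * D) * exp (2 * real N * D) * exp (- b * real N ^ 3) < 1"
    by (rule order_tendstoD) simp
  then show ?thesis
  proof eventually_elim
    case (elim N)
    have "D \<le> exp D" using exp_ge_add_one_self[of D] by linarith
    then have "D ^ (2 * N) \<le> exp D ^ (2 * N)" using D0 by (intro power_mono) auto
    also have "\<dots> = exp (2 * real N * D)"
      using exp_of_nat_mult[of "2 * N" D] by simp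
    finally have "(1 + 2 * real N * D) * D ^ (2 * N) * exp (- b * real N ^ 3)
        \<le> (1 + 2 * real N * D) * exp (2 * real N * D) * exp (- b * real N ^ 3)"
      using D0 by (intro mult_right_mono mult_left_mono) auto
    then show ?case using elim unfolding amplification_def D_def[symmetric] by linarith
  qed
qed

text \<open>
  With \<open>N\<close> fixed the loss tends to \<open>1 + 2 * N\<close>, so any exponential in \<open>\<Delta>\<close> absorbs it and the
  bound becomes uniform in \<open>N\<close>.
\<close>

lemma amplification_large_step:
  assumes "0 < \<kappa>"
  shows "\<forall>\<^sub>F \<Delta> in at_top. amplification \<kappa> \<Delta> N * exp (- \<Delta>) \<le> 1"
proof -
  have D: "((\<lambda>\<Delta>. inv_gap \<kappa> \<Delta>) \<longlongrightarrow> 1) at_top"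
    unfolding inv_gap_def using assms by real_asymp
  have e: "((\<lambda>\<Delta>::real. exp (- \<Delta>)) \<longlongrightarrow> 0) at_top" by real_asymp
  have "((\<lambda>\<Delta>. amplification \<kappa> \<Delta> N * exp (- \<Delta>)) \<longlongrightarrow> (1 + 2 * real N * 1) * 1 ^ (2 * N) * 0) at_top"
    unfolding amplification_def by (intro tendsto_intros D e)
  then have "\<forall>\<^sub>F \<Delta> in at_top. amplification \<kappa> \<Delta> N * exp (- \<Delta>) < 1"
    by (rule order_tendstoD) simp
  then show ?thesis by eventually_elim simp
qed

lemma inv_gap_le: "0 < \<kappa> \<Longrightarrow> 0 < \<Delta> \<Longrightarrow> inv_gap \<kappa> \<Delta> \<le> 1 + 1 / (\<kappa> * \<Delta>)"
proof -
  assume "0 < \<kappa>" "0 < \<Delta>"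
  define x where "x = \<kappa> * \<Delta>"
  have x: "0 < x" using \<open>0 < \<kappa>\<close> \<open>0 < \<Delta>\<close> by (simp add: x_def)
  have "1 + x \<le> exp x" by (rule exp_ge_add_one_self)
  then have "exp (- x) \<le> 1 / (1 + x)"
    using x by (simp add: exp_minus inverse_eq_divide frac_le)
  then have "x / (1 + x) \<le> 1 - exp (- x)" using x by (simp add: field_simps)
  then have "1 / (1 - exp (- x)) \<le> 1 / (x / (1 + x))"
    using x by (intro divide_left_mono) (auto intro!: mult_pos_pos)
  also have "\<dots> = 1 + 1 / x" using x by (simp add: field_simps)
  finally show ?thesis by (simp add: inv_gap_def x_def)
qed

text \<open>
  With \<open>N * \<Delta> = T\<close> the quantity \<open>inv_gap\<close> is of order \<open>N\<close>, so the loss is \<open>exp (O (N * ln N))\<close>.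
  The factor \<open>1 + N / T\<close> serves amplitudes and exponents at once, since \<open>1 / \<Delta> = N / T\<close>.
\<close>

lemma amplification_fixed_horizon:
  assumes "0 < \<kappa>" "0 < T" "0 < b"
  shows "\<forall>\<^sub>F N in sequentially. (1 + real N / T) * (amplification \<kappa> (T / real N) N * exp (- b * real N ^ 2)) \<le> 1"
proof -
  define a where "a = \<kappa> * T"
  have a: "0 < a" using assms by (simp add: a_def)
  have "((\<lambda>N. (1 + real N / T) * ((1 + 2 * real N * (1 + real N / a)) *
      exp (2 * real N * ln (1 + real N / a)) * exp (- b * real N ^ 2))) \<longlongrightarrow> 0) sequentially"
    using a assms by real_asymp
  then have "\<forall>\<^sub>F N in sequentially. (1 + real N / T) * ((1 + 2 * real N * (1 + real N / a)) *
      exp (2 * real N * ln (1 + real N / a)) * exp (- b * real N ^ 2)) < 1"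
    by (rule order_tendstoD) simp
  with eventually_gt_at_top[of 0] show ?thesis
  proof eventually_elim
    case (elim N)
    let ?D = "inv_gap \<kappa> (T / real N)"
    have D: "1 \<le> ?D" "?D \<le> 1 + real N / a"
      using inv_gap_ge_1[of \<kappa> "T / real N"] inv_gap_le[of \<kappa> "T / real N"] assms elim
      by (auto simp: a_def)
    have "0 < 1 + real N / a" using a by (simp add: add_pos_nonneg)
    then have pow: "(1 + real N / a) ^ (2 * N) = exp (2 * real N * ln (1 + real N / a))"
      using exp_of_nat_mult[of "2 * N" "ln (1 + real N / a)"] by simp
    have "amplification \<kappa> (T / real N) N \<le> (1 + 2 * real N * (1 + real N / a)) * (1 + real N / a) ^ (2 * N)"
      unfolding amplification_def using D a
      by (intro mult_mono add_mono power_mono mult_left_mono) auto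
    then have "(1 + real N / T) * (amplification \<kappa> (T / real N) N * exp (- b * real N ^ 2))
      \<le> (1 + real N / T) * ((1 + 2 * real N * (1 + real N / a)) * (1 + real N / a) ^ (2 * N) * exp (- b * real N ^ 2))"
      using assms by (intro mult_left_mono mult_right_mono) auto
    then show ?case using elim unfolding pow by linarith
  qed
qed

theorem theorem2:
  fixes p q :: "real \<Rightarrow> real" and lam :: "nat \<Rightarrow> real"
    and l M \<eta> :: real and N2 :: nat
  assumes "smooth_on_unit_interval p" and "smooth_on_unit_interval q"
    and "\<forall>x\<in>{0..1}. 0 < p x"
    and "SL_eigenvalue_sequence p q lam"
    and "1 < l" and "0 < M"
    and "0 < \<eta>" and "\<eta> < 1"
  shows
    "(\<exists>\<Gamma>>0. \<forall>\<Delta>>0. \<exists>\<gamma>y>0. \<exists>\<gamma>l>0. \<forall>\<^sub>F N1 in sequentially.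
        \<forall>y yh lamh. admissible_amplitudes l M N1 N2 y \<and> solution_branch N1 N2 \<Delta> lam y yh lamh \<longrightarrow>
          max_condition \<eta> N1 yh \<le> \<gamma>y * exp (- \<Gamma> * \<Delta> * real N1 ^ 3) \<and>
          max_condition \<eta> N1 lamh \<le> \<gamma>l * exp (- \<Gamma> * \<Delta> * real N1 ^ 3))
   \<and> (\<forall>\<theta>>0. \<exists>N0. \<exists>\<gamma>y>0. \<exists>\<gamma>l>0. \<forall>N1\<ge>N0. \<forall>\<^sub>F \<Delta> in at_top.
        \<forall>y yh lamh. admissible_amplitudes l M N1 N2 y \<and> solution_branch N1 N2 \<Delta> lam y yh lamh \<longrightarrow>
          max_condition \<eta> N1 yh \<le> \<gamma>y * exp (- \<theta> * \<Delta>) \<and>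
          max_condition \<eta> N1 lamh \<le> \<gamma>l / \<Delta> * exp (- \<theta> * \<Delta>))
   \<and> (\<forall>T>0. \<exists>\<gamma>y>0. \<exists>\<gamma>l>0. \<exists>\<Gamma>>0. \<forall>\<^sub>F N1 in sequentially.
        \<forall>y yh lamh. admissible_amplitudes l M N1 N2 y \<and>
            solution_branch N1 N2 (T / real N1) lam y yh lamh \<longrightarrow>
          max_condition \<eta> N1 yh \<le> \<gamma>y * exp (- \<Gamma> * real N1 ^ 2) \<and>
          max_condition \<eta> N1 lamh \<le> \<gamma>l * exp (- \<Gamma> * real N1 ^ 2))"
proof -
  have mono: "strict_mono_on {1..} lam" and lim: "filterlim lam at_top sequentially"
    and ev: "\<And>n. 1 \<le> n \<Longrightarrow> SL_eigenvalue p q (lam n)"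
    using assms(4) unfolding SL_eigenvalue_sequence_def by auto
  obtain g where g: "0 < g" and gap: "\<And>\<mu> \<mu>'. 1 \<le> \<mu> \<Longrightarrow> \<mu> < \<mu>' \<Longrightarrow> SL_eigenvalue p q \<mu> \<Longrightarrow>
      SL_eigenvalue p q \<mu>' \<Longrightarrow> g * sqrt \<mu> \<le> \<mu>' - \<mu>"
    using SL_eigenvalue_gap[OF assms(1-3)] by blast
  have "g * sqrt (lam n) \<le> lam (Suc n) - lam n" if "1 \<le> n" "1 \<le> lam n" for n
    by (rule gap) (use that ev strict_mono_onD[OF mono, of n "Suc n"] in auto)
  from consecutive_gaps_linear[OF mono lim g this]
  obtain \<kappa>0 where "0 < \<kappa>0" "\<And>n. 1 \<le> n \<Longrightarrow> \<kappa>0 * real n \<le> lam (Suc n) - lam n" by blast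
  then obtain \<kappa> c A where \<kappa>: "0 < \<kappa>" and c: "0 < c" and A: "0 < A"
    and bound: "\<And>N1 \<Delta> y yh lamh. \<lbrakk>0 < \<Delta>; 1 \<le> \<eta> * real N1; admissible_amplitudes l M N1 N2 y;
        solution_branch N1 N2 \<Delta> lam y yh lamh\<rbrakk> \<Longrightarrow>
      max_condition \<eta> N1 yh \<le> A * (amplification \<kappa> \<Delta> N1 * exp (- 2 * c * \<Delta> * real N1 ^ 3)) \<and>
      max_condition \<eta> N1 lamh \<le> A / \<Delta> * (amplification \<kappa> \<Delta> N1 * exp (- 2 * c * \<Delta> * real N1 ^ 3))"
    using max_condition_bound[OF _ _ assms(5-8)] by metis
  have N\<eta>: "1 \<le> \<eta> * real N" if "nat \<lceil>1 / \<eta>\<rceil> \<le> N" for N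
  proof -
    have "1 / \<eta> \<le> real N" using that by linarith
    then show ?thesis using \<open>0 < \<eta>\<close> by (simp add: field_simps)
  qed
  \<comment> \<open>One half of the gain \<open>exp (- 2 * c * \<Delta> * N1 ^ 3)\<close> pays for the loss, the other half is the bound.\<close>
  have regime1: "\<forall>\<^sub>F N1 in sequentially.
        \<forall>y yh lamh. admissible_amplitudes l M N1 N2 y \<and> solution_branch N1 N2 \<Delta> lam y yh lamh \<longrightarrow>
          max_condition \<eta> N1 yh \<le> A * exp (- c * \<Delta> * real N1 ^ 3) \<and>
          max_condition \<eta> N1 lamh \<le> A / \<Delta> * exp (- c * \<Delta> * real N1 ^ 3)"
    if \<Delta>: "0 < \<Delta>" for \<Delta>
    using amplification_fixed_step[OF \<kappa> \<Delta> mult_pos_pos[OF c \<Delta>]] eventually_ge_at_top[of "nat \<lceil>1 / \<eta>\<rceil>"]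
  proof eventually_elim
    case (elim N)
    have "amplification \<kappa> \<Delta> N * exp (- 2 * c * \<Delta> * real N ^ 3)
        = amplification \<kappa> \<Delta> N * exp (- (c * \<Delta>) * real N ^ 3) * exp (- c * \<Delta> * real N ^ 3)"
      by (simp add: mult.assoc exp_add[symmetric])
    also have "\<dots> \<le> 1 * exp (- c * \<Delta> * real N ^ 3)"
      using elim(1) by (intro mult_right_mono) auto
    finally have le: "amplification \<kappa> \<Delta> N * exp (- 2 * c * \<Delta> * real N ^ 3) \<le> exp (- c * \<Delta> * real N ^ 3)"
      by simp
    show ?case
    proof (intro allI impI, elim conjE)
      fix y yh lamh assume "admissible_amplitudes l M N N2 y" "solution_branch N N2 \<Delta> lam y yh lamh"
      from bound[OF \<Delta> N\<eta>[OF elim(2)] this] mult_left_mono[OF le less_imp_le[OF A]]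
        mult_left_mono[OF le less_imp_le[OF divide_pos_pos[OF A \<Delta>]]]
      show "max_condition \<eta> N yh \<le> A * exp (- c * \<Delta> * real N ^ 3) \<and>
          max_condition \<eta> N lamh \<le> A / \<Delta> * exp (- c * \<Delta> * real N ^ 3)"
        by (blast intro: order_trans)
    qed
  qed
  \<comment> \<open>For \<open>2 * c * N ^ 3 \<ge> \<theta> + 1\<close> a factor \<open>exp (- \<Delta>)\<close> is left over to pay for the loss.\<close>
  have regime2: "\<forall>\<^sub>F \<Delta> in at_top.
        \<forall>y yh lamh. admissible_amplitudes l M N N2 y \<and> solution_branch N N2 \<Delta> lam y yh lamh \<longrightarrow>
          max_condition \<eta> N yh \<le> A * exp (- \<theta> * \<Delta>) \<and>
          max_condition \<eta> N lamh \<le> A / \<Delta> * exp (- \<theta> * \<Delta>)"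
    if \<theta>: "0 < \<theta>" and N: "max (nat \<lceil>1 / \<eta>\<rceil>) (nat \<lceil>(\<theta> + 1) / (2 * c)\<rceil>) \<le> N" for \<theta> N
    using amplification_large_step[OF \<kappa>, of N] eventually_gt_at_top[of 0]
  proof eventually_elim
    case (elim \<Delta>)
    have N1: "nat \<lceil>1 / \<eta>\<rceil> \<le> N" using N by simp
    have "(\<theta> + 1) / (2 * c) \<le> real N" using N by linarith
    also have "real N \<le> real N ^ 3"
      using self_le_power[of "real N" 3] N\<eta>[OF N1] by (cases N) auto
    finally have "\<theta> + 1 \<le> 2 * c * real N ^ 3" using c by (simp add: field_simps)
    then have "(\<theta> + 1) * \<Delta> \<le> 2 * c * real N ^ 3 * \<Delta>" using elim by (intro mult_right_mono) auto
    then have "exp (- 2 * c * \<Delta> * real N ^ 3) \<le> exp (- \<Delta>) * exp (- \<theta> * \<Delta>)"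
      by (simp add: exp_add[symmetric] algebra_simps)
    then have "amplification \<kappa> \<Delta> N * exp (- 2 * c * \<Delta> * real N ^ 3)
        \<le> amplification \<kappa> \<Delta> N * (exp (- \<Delta>) * exp (- \<theta> * \<Delta>))"
      using amplification_nonneg[OF \<kappa> elim(2)] by (intro mult_left_mono) auto
    also have "\<dots> \<le> 1 * exp (- \<theta> * \<Delta>)"
      unfolding mult.assoc[symmetric] using elim(1) by (intro mult_right_mono) auto
    finally have le: "amplification \<kappa> \<Delta> N * exp (- 2 * c * \<Delta> * real N ^ 3) \<le> exp (- \<theta> * \<Delta>)"
      by simp
    show ?case
    proof (intro allI impI, elim conjE)
      fix y yh lamh assume "admissible_amplitudes l M N N2 y" "solution_branch N N2 \<Delta> lam y yh lamh"
      from bound[OF elim(2) N\<eta>[OF N1] this] mult_left_mono[OF le less_imp_le[OF A]]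
        mult_left_mono[OF le less_imp_le[OF divide_pos_pos[OF A elim(2)]]]
      show "max_condition \<eta> N yh \<le> A * exp (- \<theta> * \<Delta>) \<and>
          max_condition \<eta> N lamh \<le> A / \<Delta> * exp (- \<theta> * \<Delta>)"
        by (blast intro: order_trans)
    qed
  qed
  \<comment> \<open>Here \<open>\<Delta> * N1 ^ 3 = T * N1 ^ 2\<close>, and the gain is split in halves again.\<close>
  have regime3: "\<forall>\<^sub>F N1 in sequentially.
        \<forall>y yh lamh. admissible_amplitudes l M N1 N2 y \<and>
            solution_branch N1 N2 (T / real N1) lam y yh lamh \<longrightarrow>
          max_condition \<eta> N1 yh \<le> A * exp (- (c * T) * real N1 ^ 2) \<and>
          max_condition \<eta> N1 lamh \<le> A * exp (- (c * T) * real N1 ^ 2)"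
    if T: "0 < T" for T
    using amplification_fixed_horizon[OF \<kappa> T mult_pos_pos[OF c T]]
      eventually_ge_at_top[of "nat \<lceil>1 / \<eta>\<rceil>"] eventually_gt_at_top[of 0]
  proof eventually_elim
    case (elim N)
    let ?\<Delta> = "T / real N" and ?e = "exp (- (c * T) * real N ^ 2)"
    let ?X = "amplification \<kappa> ?\<Delta> N * exp (- 2 * c * ?\<Delta> * real N ^ 3)"
    have \<Delta>: "0 < ?\<Delta>" using T elim by simp
    have "- 2 * c * ?\<Delta> * real N ^ 3 = - (c * T) * real N ^ 2 + - (c * T) * real N ^ 2"
      using elim by (simp add: power2_eq_square power3_eq_cube)
    then have "exp (- 2 * c * ?\<Delta> * real N ^ 3) = ?e * ?e"
      by (simp only: exp_add)
    then have "(1 + real N / T) * ?X = (1 + real N / T) * (amplification \<kappa> ?\<Delta> N * ?e) * ?e"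
      by simp
    also have "\<dots> \<le> 1 * ?e" using elim(1) by (intro mult_right_mono) auto
    finally have le: "?X + real N / T * ?X \<le> ?e" by (simp add: algebra_simps)
    have X: "0 \<le> ?X" using amplification_nonneg[OF \<kappa> \<Delta>] by simp
    have NX: "0 \<le> real N / T * ?X" using X T by simp
    have le1: "A * ?X \<le> A * ?e" and le2: "A / ?\<Delta> * ?X \<le> A * ?e"
      using mult_left_mono[of ?X ?e A] mult_left_mono[of "real N / T * ?X" ?e A] X NX le A by auto
    show ?case
    proof (intro allI impI, elim conjE)
      fix y yh lamh assume "admissible_amplitudes l M N N2 y" "solution_branch N N2 ?\<Delta> lam y yh lamh"
      from bound[OF \<Delta> N\<eta>[OF elim(2)] this] le1 le2
      show "max_condition \<eta> N yh \<le> A * ?e \<and> max_condition \<eta> N lamh \<le> A * ?e"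
        by (blast intro: order_trans)
    qed
  qed
  have "\<exists>\<gamma>y>0. \<exists>\<gamma>l>0. \<forall>\<^sub>F N1 in sequentially.
        \<forall>y yh lamh. admissible_amplitudes l M N1 N2 y \<and> solution_branch N1 N2 \<Delta> lam y yh lamh \<longrightarrow>
          max_condition \<eta> N1 yh \<le> \<gamma>y * exp (- c * \<Delta> * real N1 ^ 3) \<and>
          max_condition \<eta> N1 lamh \<le> \<gamma>l * exp (- c * \<Delta> * real N1 ^ 3)" if "0 < \<Delta>" for \<Delta>
    by (rule exI[of _ A], rule conjI[OF A], rule exI[of _ "A / \<Delta>"],
        rule conjI[OF divide_pos_pos[OF A that]], rule regime1[OF that])
  moreover have "\<exists>N0. \<exists>\<gamma>y>0. \<exists>\<gamma>l>0. \<forall>N1\<ge>N0. \<forall>\<^sub>F \<Delta> in at_top.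
        \<forall>y yh lamh. admissible_amplitudes l M N1 N2 y \<and> solution_branch N1 N2 \<Delta> lam y yh lamh \<longrightarrow>
          max_condition \<eta> N1 yh \<le> \<gamma>y * exp (- \<theta> * \<Delta>) \<and>
          max_condition \<eta> N1 lamh \<le> \<gamma>l / \<Delta> * exp (- \<theta> * \<Delta>)" if "0 < \<theta>" for \<theta>
    by (rule exI, rule exI[of _ A], rule conjI[OF A], rule exI[of _ A], rule conjI[OF A],
        intro allI impI, rule regime2[OF that])
  moreover have "\<exists>\<gamma>y>0. \<exists>\<gamma>l>0. \<exists>\<Gamma>>0. \<forall>\<^sub>F N1 in sequentially.
        \<forall>y yh lamh. admissible_amplitudes l M N1 N2 y \<and>
            solution_branch N1 N2 (T / real N1) lam y yh lamh \<longrightarrow>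
          max_condition \<eta> N1 yh \<le> \<gamma>y * exp (- \<Gamma> * real N1 ^ 2) \<and>
          max_condition \<eta> N1 lamh \<le> \<gamma>l * exp (- \<Gamma> * real N1 ^ 2)" if "0 < T" for T
    by (rule exI[of _ A], rule conjI[OF A], rule exI[of _ A], rule conjI[OF A],
        rule exI[of _ "c * T"], rule conjI[OF mult_pos_pos[OF c that]], rule regime3[OF that])
  ultimately show ?thesis using c by blast
qed

end
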